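(* Let $n\ge2$ be an integer, $\lambda=\frac{n-1}{2}$, and $m\in\mathbb N=\{1,2,\dots\}$. The normalized Poisson wavelets $$\widetilde G_a^m=\sum_{l=0}^\infty\gamma_m(al)\,\mathcal K_l^\lambda,\quad a\in\mathbb R_+,\qquad\text{with}\qquad\gamma_m(t)=\frac{1}{\Gamma(m)}\,t^me^{-t},$$ form a spherical linear wavelet; that is, $\{\widetilde G_a^m\}_{a\in\mathbb R_+}$ is a family of zonal $\mathcal L^2(\mathcal S^n)$-functions satisfying 1. for every $l\in\mathbb N_0=\{0,1,2,\dots\}$, $\displaystyle\int_0^\infty\widehat{\widetilde G_a^m}(l)\,\frac{da}{a}=\frac{\lambda+l}{\lambda}$; 2. for every $R\in\mathbb R_+$, $$\int_{-1}^1\left|\int_R^\infty\widetilde G_a^m(t)\,\frac{da}{a}\right|\left(1-t^2\right)^{\lambda-1/2}dt\le\mathfrak c$$ with a constant $\mathfrak c$ independent of $R$.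
   Context: $\mathcal S^n$ is the unit sphere in $\mathbb R^{n+1}$; $\hat e=(1,0,\dots,0)$. The Gegenbauer polynomials $C_l^\lambda$ are defined by $\sum_{l=0}^\infty C_l^\lambda(t)\,r^l=(1-2tr+r^2)^{-\lambda}$ for $t\in[-1,1]$, $|r|<1$, and $\mathcal K_l^\lambda=\frac{\lambda+l}{\lambda}\,C_l^\lambda$. Zonal functions on $\mathcal S^n$ (functions of $t=\hat e\cdot x$ only) are identified with functions on $[-1,1]$. The Gegenbauer coefficients $\hat f(l)$ of a zonal function $f$ are the coefficients in its expansion $f=\sum_{l=0}^\infty\hat f(l)\,C_l^\lambda$.
   Formalization: Condition 1 is proved only for l ≥ 1: at l = 0 it is false, since γ_m(0) = 0 for m ≥ 1 makes the degree-0 coefficient vanish, so the integral is 0 and not (λ+0)/λ = 1. *)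

theory Defs
  imports "HOL-Analysis.Analysis"
begin

section \<open>Zonal functions on the sphere\<close>

text \<open>
  The sphere of dimension \<open>n\<close> is \<open>sphere 0 1\<close> in a Euclidean space of dimension \<open>n + 1\<close>. Its
  surface measure gives a set \<open>A\<close> the volume of the cone over \<open>A\<close> in the unit ball, times
  the dimension of the space; note that \<open>sgn x\<close> is \<open>x\<close> divided by its norm.
\<close>

definition sphere_surface :: "'a::euclidean_space measure" where
  "sphere_surface =
     scale_measure (ennreal (real DIM('a)))
       (distr (restrict_space lborel (cball 0 1 - {0})) (restrict_space borel (sphere 0 1)) sgn)"

lemma measurable_sgn_sphere:
  "(sgn :: 'a::euclidean_space \<Rightarrow> 'a)
     \<in> measurable (restrict_space lborel (cball 0 1 - {0})) (restrict_space borel (sphere 0 1))"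
proof (rule measurable_restrict_space2)
  show "(sgn :: 'a \<Rightarrow> 'a)
      \<in> space (restrict_space lborel (cball 0 1 - {0})) \<rightarrow> sphere 0 1"
    by (auto simp: space_restrict_space norm_sgn)
  show "(sgn :: 'a \<Rightarrow> 'a) \<in> borel_measurable (restrict_space lborel (cball 0 1 - {0}))"
    unfolding sgn_div_norm[abs_def] by (intro measurable_restrict_space1) measurable
qed

lemma emeasure_sphere_surface:
  assumes "A \<in> sets (restrict_space borel (sphere (0::'a::euclidean_space) 1))"
  shows "emeasure (sphere_surface :: 'a measure) A =
    ennreal (real DIM('a)) * emeasure lborel {x \<in> cball 0 1 - {0}. sgn x \<in> A}"
proof -
  have "emeasure (sphere_surface :: 'a measure) A = ennreal (real DIM('a)) *
      emeasure (restrict_space lborel (cball 0 1 - {0})) (sgn -` A \<inter> (cball 0 1 - {0}))"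
    unfolding sphere_surface_def emeasure_scale_measure
    using assms
    by (subst emeasure_distr[OF measurable_sgn_sphere]) (auto simp: space_restrict_space)
  also have "emeasure (restrict_space lborel (cball (0::'a) 1 - {0})) (sgn -` A \<inter> (cball 0 1 - {0}))
      = emeasure lborel (sgn -` A \<inter> (cball 0 1 - {0}))"
    by (rule emeasure_restrict_space) auto
  also have "sgn -` A \<inter> (cball 0 1 - {0}) = {x \<in> cball 0 1 - {0}. sgn x \<in> A}"
    by auto
  finally show ?thesis .
qed

text \<open>
  A function \<open>f\<close> on \<open>[-1, 1]\<close> stands for the zonal function \<open>x \<mapsto> f (e \<bullet> x)\<close> on the sphere;
  the values of \<open>f\<close> outside \<open>[-1, 1]\<close> are never used.
\<close>

definition zonal_L2 :: "'a::euclidean_space \<Rightarrow> (real \<Rightarrow> real) \<Rightarrow> bool" where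
  "zonal_L2 e f \<longleftrightarrow>
     (\<lambda>x. f (e \<bullet> x)) \<in> borel_measurable sphere_surface \<and>
     integrable sphere_surface (\<lambda>x. (f (e \<bullet> x))\<^sup>2)"


section \<open>Gegenbauer polynomials and Gegenbauer coefficients\<close>

text \<open>
  Only meaningful for \<open>t\<close> in \<open>[-1, 1]\<close>, where \<open>1 - 2 * t * r + r\<^sup>2\<close> is positive for all
  \<open>\<bar>r\<bar> < 1\<close>.
\<close>

definition gegenbauer :: "real \<Rightarrow> nat \<Rightarrow> real \<Rightarrow> real" where
  "gegenbauer lam l t =
     (THE c :: nat \<Rightarrow> real. \<forall>r. \<bar>r\<bar> < 1 \<longrightarrow>
        (\<lambda>k. c k * r ^ k) sums ((1 - 2 * t * r + r\<^sup>2) powr (- lam))) l"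

definition gegenbauer_kernel :: "real \<Rightarrow> nat \<Rightarrow> real \<Rightarrow> real" where
  "gegenbauer_kernel lam l t = (lam + real l) / lam * gegenbauer lam l t"

text \<open>
  This is, up to a constant factor, the density of the push-forward of the surface measure
  under \<open>x \<mapsto> e \<bullet> x\<close>. For \<open>lam = 1 / 2\<close> it is 0 instead of 1 at \<open>t = 1\<close> and \<open>t = -1\<close>, since
  \<open>0 powr 0 = 0\<close>; this does not affect any integral.
\<close>

definition gegenbauer_weight :: "real \<Rightarrow> real \<Rightarrow> real" where
  "gegenbauer_weight lam t = (1 - t\<^sup>2) powr (lam - 1 / 2)"

text \<open>
  The expansion of a zonal square-integrable function converges in the sense of \<open>L\<^sup>2\<close>. Since
  the Bochner integral of a non-integrable function is 0, integrability is required explicitly,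
  here and below.
\<close>

definition gegenbauer_expansion :: "real \<Rightarrow> (real \<Rightarrow> real) \<Rightarrow> (nat \<Rightarrow> real) \<Rightarrow> bool" where
  "gegenbauer_expansion lam f c \<longleftrightarrow>
     set_borel_measurable lborel {-1..1} f \<and>
     (\<forall>N. set_integrable lborel {-1..1}
        (\<lambda>t. (f t - (\<Sum>l<N. c l * gegenbauer lam l t))\<^sup>2 * gegenbauer_weight lam t)) \<and>
     (\<lambda>N. LINT t:{-1..1}|lborel.
        (f t - (\<Sum>l<N. c l * gegenbauer lam l t))\<^sup>2 * gegenbauer_weight lam t) \<longlonglongrightarrow> 0"

definition gegenbauer_coeff :: "real \<Rightarrow> (real \<Rightarrow> real) \<Rightarrow> nat \<Rightarrow> real" where
  "gegenbauer_coeff lam f = (THE c. gegenbauer_expansion lam f c)"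


section \<open>Spherical linear wavelets\<close>

text \<open>
  The set \<open>L\<close> collects the degrees at which the admissibility condition on the Gegenbauer
  coefficients is imposed. The choice \<open>L = {1..}\<close> is the one for wavelets of mean zero: their
  coefficients of degree 0 vanish, so that the condition cannot hold at degree 0.
\<close>

definition spherical_linear_wavelet ::
    "nat set \<Rightarrow> 'a::euclidean_space \<Rightarrow> real \<Rightarrow> (real \<Rightarrow> real \<Rightarrow> real) \<Rightarrow> bool" where
  "spherical_linear_wavelet L e lam \<Psi> \<longleftrightarrow>
     (\<forall>a>0. zonal_L2 e (\<Psi> a) \<and> (\<exists>!c. gegenbauer_expansion lam (\<Psi> a) c)) \<and>
     (\<forall>l\<in>L.
        set_integrable lborel {0<..} (\<lambda>a. gegenbauer_coeff lam (\<Psi> a) l / a) \<and>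
        (LINT a:{0<..}|lborel. gegenbauer_coeff lam (\<Psi> a) l / a) = (lam + real l) / lam) \<and>
     (\<forall>R>0. AE t in lborel. t \<in> {-1..1} \<longrightarrow> set_integrable lborel {R<..} (\<lambda>a. \<Psi> a t / a)) \<and>
     (\<exists>C. \<forall>R>0.
        set_integrable lborel {-1..1}
          (\<lambda>t. \<bar>LINT a:{R<..}|lborel. \<Psi> a t / a\<bar> * gegenbauer_weight lam t) \<and>
        (LINT t:{-1..1}|lborel.
          \<bar>LINT a:{R<..}|lborel. \<Psi> a t / a\<bar> * gegenbauer_weight lam t) \<le> C)"

definition poisson_profile :: "nat \<Rightarrow> real \<Rightarrow> real" where
  "poisson_profile m t = 1 / Gamma (real m) * t ^ m * exp (- t)"

definition poisson_wavelet :: "real \<Rightarrow> nat \<Rightarrow> real \<Rightarrow> real \<Rightarrow> real" where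
  "poisson_wavelet lam m a t =
     (\<Sum>l. poisson_profile m (a * real l) * gegenbauer_kernel lam l t)"

end

theory Submission
  imports Defs "HOL-Complex_Analysis.Cauchy_Integral_Formula"
begin

text \<open>
  Write \<open>K\<^sub>l\<close> for the kernel of degree \<open>l\<close> and \<open>w\<close> for the weight. The wavelet at scale
  \<open>a\<close> is the series of the \<open>K\<^sub>l\<close> with coefficients \<open>poisson_profile m (a l)\<close>. These decay
  exponentially in \<open>l\<close>, while \<open>K\<^sub>l\<close> is bounded on \<open>[-1, 1]\<close> by its value at 1, a coefficient
  of a power series of radius 1 (\<open>abs_gegenbauer_kernel_le\<close>, \<open>summable_gegenbauer_kernel_1\<close>).
  Hence the series converges uniformly; its sum is continuous, square integrable, and has the
  evident Gegenbauer expansion. That this is the only expansion follows from the orthogonality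
  of the Gegenbauer polynomials (\<open>gegenbauer_orthogonal\<close>), which comes from their differential
  equation. The admissibility condition then is the statement that the integral of
  \<open>poisson_profile m x / x\<close> over the positive half-line is 1.

  The essential point is the bound uniform in \<open>R\<close>. Integration of the profile gives
  \<open>exp (- x) * (\<Sum>j<m. x\<^sup>j / j!)\<close>, called \<open>poisson_tail m x\<close>, so the integral of the wavelets
  over \<open>a > R\<close>, increased by 1, is
  \<open>\<Sum>j<m. R\<^sup>j / j! * (\<Sum>l. l\<^sup>j exp (- R l) K\<^sub>l(t))\<close>.
  The inner sum is, up to sign, the \<open>j\<close>-th derivative with respect to \<open>R\<close> of the Poisson kernel
  \<open>P\<^sub>R(t) = (\<Sum>l. exp (- R l) K\<^sub>l(t))\<close>. With \<open>r = exp (- R)\<close> this is the positive function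
  \<open>(1 - r\<^sup>2) / (1 - 2 t r + r\<^sup>2) powr (lam + 1)\<close>. It extends holomorphically to complex \<open>\<zeta>\<close> with
  positive real part in place of \<open>R\<close>, and on the disc of radius \<open>R / 2\<close> around \<open>R\<close> the modulus
  of the extension is at most \<open>2 * 4 powr (lam + 1) * P\<^sub>R(t)\<close>
  (\<open>norm_poisson_kernel_comparison\<close>). Cauchy's inequality on this disc therefore yields
  \<open>R\<^sup>j / j! * \<bar>\<partial>\<^sup>j P\<^sub>R(t)\<bar> \<le> 2\<^sup>j * 2 * 4 powr (lam + 1) * P\<^sub>R(t)\<close>
  pointwise (\<open>abs_kernel_series_poisson_tail_le\<close>). Because \<open>P\<^sub>R\<close> is nonnegative, its
  weighted \<open>L\<^sup>1\<close> norm is its integral against \<open>w\<close>; by orthogonality only the term of degree 0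
  contributes, and the norm equals the total weight for every \<open>R\<close>.
\<close>

section \<open>The generating function on the unit circle\<close>

definition neg_binomial_coeff :: "real \<Rightarrow> nat \<Rightarrow> real" where
  "neg_binomial_coeff lam k = pochhammer lam k / fact k"

lemma neg_binomial_coeff_pos: "lam > 0 \<Longrightarrow> neg_binomial_coeff lam k > 0"
  by (simp add: neg_binomial_coeff_def pochhammer_pos)

lemmas neg_binomial_coeff_nonneg = neg_binomial_coeff_pos[THEN less_imp_le]

lemma neg_binomial_coeff_Suc:
  "real (Suc k) * neg_binomial_coeff lam (Suc k) = (lam + real k) * neg_binomial_coeff lam k"
  unfolding neg_binomial_coeff_def pochhammer_Suc fact_Suc of_nat_mult
  by (simp del: of_nat_Suc add: mult.commute)

lemma neg_binomial_coeff_shift: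
  assumes "lam > 0"
  shows "real (Suc k) / lam * neg_binomial_coeff lam (Suc k) = neg_binomial_coeff (lam + 1) k"
  unfolding neg_binomial_coeff_def pochhammer_rec fact_Suc of_nat_mult
  using assms by (simp del: of_nat_Suc)

lemma neg_binomial_series:
  fixes z :: complex
  assumes "norm z < 1"
  shows "(\<lambda>k. of_real (neg_binomial_coeff lam k) * z ^ k) sums (1 - z) powr (- of_real lam)"
proof -
  have "((- of_real lam :: complex) gchoose k) * (- z) ^ k
      = of_real (neg_binomial_coeff lam k) * z ^ k" for k
  proof -
    have "(-1) ^ k * (- z) ^ k = z ^ k"
      by (simp flip: power_mult_distrib)
    thus ?thesis
      by (simp add: gbinomial_pochhammer neg_binomial_coeff_def pochhammer_of_real mult_ac)
  qed
  thus ?thesis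
    using gen_binomial_complex[of "- z" "- of_real lam"] assms by simp
qed

lemma neg_binomial_summable:
  fixes z :: complex
  assumes "norm z < 1" "lam > 0"
  shows "summable (\<lambda>k. norm (of_real (neg_binomial_coeff lam k) * z ^ k))"
proof -
  have "summable (\<lambda>k. of_real (neg_binomial_coeff lam k) * (of_real (norm z) :: complex) ^ k)"
    using neg_binomial_series[of "of_real (norm z)" lam] assms(1) by (auto intro: sums_summable)
  hence "summable (\<lambda>k. complex_of_real (neg_binomial_coeff lam k * norm z ^ k))"
    by simp
  hence "summable (\<lambda>k. neg_binomial_coeff lam k * norm z ^ k)"
    by (simp only: summable_of_real_iff)
  thus ?thesis
    using neg_binomial_coeff_nonneg[OF assms(2)] by (simp add: norm_mult norm_power)
qed

text \<open>
  The factor \<open>k / lam\<close> raises the exponent \<open>lam\<close> of the binomial series by one and shifts its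
  index.
\<close>

lemma weighted_neg_binomial_series:
  fixes z :: complex
  assumes "norm z < 1" "lam > 0"
  shows "(\<lambda>k. of_real (real k / lam * neg_binomial_coeff lam k) * z ^ k)
           sums (z / (1 - z) * (1 - z) powr (- of_real lam))"
    and "summable (\<lambda>k. norm (of_real (real k / lam * neg_binomial_coeff lam k) * z ^ k))"
proof -
  have eq: "of_real (real (Suc k) / lam * neg_binomial_coeff lam (Suc k)) * z ^ Suc k
      = z * (of_real (neg_binomial_coeff (lam + 1) k) * z ^ k)" for k
    unfolding neg_binomial_coeff_shift[OF assms(2)] by simp
  have "z \<noteq> 1" using assms(1) by auto
  hence "(1 - z) powr (- of_real (lam + 1)) = (1 - z) powr (- of_real lam) / (1 - z)"
    by (simp add: powr_diff)
  hence "(\<lambda>k. of_real (real (Suc k) / lam * neg_binomial_coeff lam (Suc k)) * z ^ Suc k)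
          sums (z / (1 - z) * (1 - z) powr (- of_real lam))"
    unfolding eq using sums_mult[OF neg_binomial_series[OF assms(1), of "lam + 1"], of z]
    by (simp add: mult_ac)
  from sums_Suc[OF this]
  show "(\<lambda>k. of_real (real k / lam * neg_binomial_coeff lam k) * z ^ k)
           sums (z / (1 - z) * (1 - z) powr (- of_real lam))" by simp
  have "summable (\<lambda>k. norm (of_real (real (Suc k) / lam * neg_binomial_coeff lam (Suc k)) * z ^ Suc k))"
    unfolding eq norm_mult[of z] using assms
    by (intro summable_mult neg_binomial_summable) auto
  thus "summable (\<lambda>k. norm (of_real (real k / lam * neg_binomial_coeff lam k) * z ^ k))"
    by (subst (asm) summable_Suc_iff)
qed

text \<open>
  With \<open>t = cos \<theta>\<close> and \<open>u = exp (\<i>\<theta>)\<close>, the denominator \<open>1 - 2 t r + r\<^sup>2\<close> splits into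
  \<open>(1 - u r) (1 - cnj u r)\<close>. The product of the two binomial series shows that the Gegenbauer
  polynomial is the trigonometric polynomial below. This form settles existence for all
  \<open>\<bar>r\<bar> < 1\<close> at once, allows complex \<open>r\<close>, and bounds the polynomial by its value at \<open>t = 1\<close>
  because all the binomial coefficients are positive.
\<close>

definition gegenbauer_circle :: "real \<Rightarrow> complex \<Rightarrow> nat \<Rightarrow> complex" where
  "gegenbauer_circle lam u l =
     (\<Sum>k\<le>l. of_real (neg_binomial_coeff lam k) * u ^ k *
        (of_real (neg_binomial_coeff lam (l - k)) * cnj u ^ (l - k)))"

lemma cauchy_product_circle:
  fixes a b :: "nat \<Rightarrow> real" and z u :: complex
  assumes "(\<lambda>k. of_real (a k) * (u * z) ^ k) sums A" "(\<lambda>k. of_real (b k) * (cnj u * z) ^ k) sums B"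
    and "summable (\<lambda>k. norm (of_real (a k) * (u * z) ^ k))"
    and "summable (\<lambda>k. norm (of_real (b k) * (cnj u * z) ^ k))"
  shows "(\<lambda>l. (\<Sum>k\<le>l. of_real (a k) * u ^ k * (of_real (b (l - k)) * cnj u ^ (l - k))) * z ^ l)
           sums (A * B)"
proof -
  have "(\<lambda>l. \<Sum>k\<le>l. (of_real (a k) * (u * z) ^ k) * (of_real (b (l - k)) * (cnj u * z) ^ (l - k)))
          sums (A * B)"
    using Cauchy_product_sums[OF assms(3,4)] assms(1,2) by (simp add: sums_iff)
  moreover have "(\<Sum>k\<le>l. (of_real (a k) * (u * z) ^ k) * (of_real (b (l - k)) * (cnj u * z) ^ (l - k)))
     = (\<Sum>k\<le>l. of_real (a k) * u ^ k * (of_real (b (l - k)) * cnj u ^ (l - k))) * z ^ l" for l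
    unfolding sum_distrib_right
  proof (intro sum.cong refl)
    fix k assume "k \<in> {..l}"
    hence "z ^ l = z ^ k * z ^ (l - k)" by (simp flip: power_add)
    thus "(of_real (a k) * (u * z) ^ k) * (of_real (b (l - k)) * (cnj u * z) ^ (l - k))
       = of_real (a k) * u ^ k * (of_real (b (l - k)) * cnj u ^ (l - k)) * z ^ l"
      by (simp add: power_mult_distrib mult_ac)
  qed
  ultimately show ?thesis by simp
qed

definition gegenbauer_gf :: "real \<Rightarrow> complex \<Rightarrow> complex \<Rightarrow> complex" where
  "gegenbauer_gf lam u z =
     (1 - u * z) powr (- of_real lam) * (1 - cnj u * z) powr (- of_real lam)"

text \<open>
  The generating function of the reproducing kernels. For real \<open>z\<close> it equals
  \<open>(1 - z\<^sup>2) / (1 - 2 t z + z\<^sup>2) powr (lam + 1)\<close>, the Poisson kernel of the ball. In this factored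
  form principal powers suffice to extend it to the complex unit disc.
\<close>

definition poisson_kernel :: "real \<Rightarrow> complex \<Rightarrow> complex \<Rightarrow> complex" where
  "poisson_kernel lam u z = (1 - z\<^sup>2) / ((1 - u * z) * (1 - cnj u * z)) * gegenbauer_gf lam u z"

lemma gegenbauer_circle_sums:
  fixes z u :: complex
  assumes "lam > 0" "norm u = 1" "norm z < 1"
  shows "(\<lambda>l. gegenbauer_circle lam u l * z ^ l) sums gegenbauer_gf lam u z"
  unfolding gegenbauer_circle_def gegenbauer_gf_def
  using assms by (intro cauchy_product_circle neg_binomial_series neg_binomial_summable)
                 (auto simp: norm_mult)

text \<open>
  Since \<open>(lam + l) / lam = 1 + k / lam + (l - k) / lam\<close>, the weighted series is a sum of three
  Cauchy products of the plain and the weighted binomial series. Their sum simplifies by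
  \<open>1 + p / (1 - p) + q / (1 - q) = (1 - p q) / ((1 - p) (1 - q))\<close>, where \<open>p q = z\<^sup>2\<close>.
\<close>

lemma gegenbauer_circle_kernel_sums:
  fixes z u :: complex
  assumes "lam > 0" "norm u = 1" "norm z < 1"
  shows "(\<lambda>l. of_real ((lam + real l) / lam) * gegenbauer_circle lam u l * z ^ l)
           sums poisson_kernel lam u z"
proof -
  let ?a = "neg_binomial_coeff lam" and ?b = "\<lambda>k. real k / lam * neg_binomial_coeff lam k"
  let ?A = "(1 - u * z) powr (- of_real lam)" and ?B = "(1 - cnj u * z) powr (- of_real lam)"
  let ?S = "\<lambda>a b l. \<Sum>k\<le>l. of_real (a k :: real) * u ^ k *
               (of_real (b (l - k) :: real) * cnj u ^ (l - k))"
  have uz: "norm (u * z) < 1" "norm (cnj u * z) < 1" using assms by (auto simp: norm_mult)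
  have "(\<lambda>l. ?S ?a ?a l * z ^ l + ?S ?b ?a l * z ^ l + ?S ?a ?b l * z ^ l) sums
     (?A * ?B + (u * z / (1 - u * z) * ?A) * ?B + ?A * (cnj u * z / (1 - cnj u * z) * ?B))"
    using uz assms(1)
    by (intro sums_add cauchy_product_circle neg_binomial_series neg_binomial_summable
          weighted_neg_binomial_series)
  moreover have "?S ?a ?a l * z ^ l + ?S ?b ?a l * z ^ l + ?S ?a ?b l * z ^ l
      = of_real ((lam + real l) / lam) * gegenbauer_circle lam u l * z ^ l" for l
  proof -
    have "?S ?a ?a l + ?S ?b ?a l + ?S ?a ?b l = of_real ((lam + real l) / lam) * gegenbauer_circle lam u l"
      unfolding gegenbauer_circle_def sum_distrib_left sum.distrib[symmetric]
    proof (intro sum.cong refl)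
      fix k assume "k \<in> {..l}"
      hence "(lam + real l) / lam = 1 + real k / lam + real (l - k) / lam"
        using assms(1) by (simp add: field_simps of_nat_diff)
      thus "of_real (?a k) * u ^ k * (of_real (?a (l - k)) * cnj u ^ (l - k))
          + of_real (?b k) * u ^ k * (of_real (?a (l - k)) * cnj u ^ (l - k))
          + of_real (?a k) * u ^ k * (of_real (?b (l - k)) * cnj u ^ (l - k))
          = of_real ((lam + real l) / lam) * (of_real (?a k) * u ^ k * (of_real (?a (l - k)) * cnj u ^ (l - k)))"
        by (simp only: of_real_add of_real_mult of_real_1) (simp add: algebra_simps)
    qed
    thus ?thesis by (simp flip: distrib_right)
  qed
  moreover have "?A * ?B + (u * z / (1 - u * z) * ?A) * ?B + ?A * (cnj u * z / (1 - cnj u * z) * ?B)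
     = poisson_kernel lam u z"
  proof -
    have "1 - u * z \<noteq> 0" "1 - cnj u * z \<noteq> 0"
      using uz by (metis eq_iff_diff_eq_0 less_irrefl norm_one)+
    moreover have "(u * z) * (cnj u * z) = z\<^sup>2"
      using assms(2) complex_norm_square[of u] by (simp add: power2_eq_square algebra_simps)
    moreover have "A * B + (p / (1 - p) * A) * B + A * (q / (1 - q) * B)
        = (1 - p * q) / ((1 - p) * (1 - q)) * (A * B)" if "1 - p \<noteq> 0" "1 - q \<noteq> 0"
      for p q A B :: complex
    proof -
      have "1 + p / (1 - p) + q / (1 - q) = (1 - p * q) / ((1 - p) * (1 - q))"
        using that by (simp add: field_simps)
      hence "(1 + p / (1 - p) + q / (1 - q)) * (A * B) = (1 - p * q) / ((1 - p) * (1 - q)) * (A * B)"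
        by simp
      thus ?thesis by (simp add: algebra_simps)
    qed
    ultimately show ?thesis by (simp add: poisson_kernel_def gegenbauer_gf_def)
  qed
  ultimately show ?thesis by simp
qed

lemma gegenbauer_circle_real: "gegenbauer_circle lam u l \<in> \<real>"
proof -
  have "cnj (gegenbauer_circle lam u l) = gegenbauer_circle lam u l"
    unfolding gegenbauer_circle_def cnj_sum
    by (rule sum.reindex_bij_witness[of _ "\<lambda>k. l - k" "\<lambda>k. l - k"]) (auto simp: mult_ac)
  thus ?thesis by (simp add: Reals_cnj_iff)
qed

lemma norm_gegenbauer_circle_le:
  assumes "lam > 0" "norm u = 1"
  shows "norm (gegenbauer_circle lam u l) \<le> Re (gegenbauer_circle lam 1 l)"
proof -
  have "norm (gegenbauer_circle lam u l)
      \<le> (\<Sum>k\<le>l. neg_binomial_coeff lam k * neg_binomial_coeff lam (l - k))"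
    unfolding gegenbauer_circle_def using neg_binomial_coeff_nonneg[OF assms(1)] assms(2)
    by (intro order_trans[OF norm_sum] sum_mono) (auto simp: norm_mult norm_power)
  thus ?thesis by (simp add: gegenbauer_circle_def)
qed

lemma gegenbauer_gf_real:
  assumes "norm u = 1" "\<bar>r\<bar> < 1"
  shows "gegenbauer_gf lam u (of_real r) = of_real ((1 - 2 * Re u * r + r\<^sup>2) powr (- lam))"
proof -
  let ?w = "1 - u * of_real r"
  have "norm (u * of_real r) < 1" using assms by (simp add: norm_mult)
  hence pos: "Re ?w > 0"
    using complex_Re_le_cmod[of "u * of_real r"] by simp
  have "cnj ?w powr (- of_real lam) = cnj (?w powr (- of_real lam))"
    using pos by (subst cnj_powr) auto
  hence "gegenbauer_gf lam u (of_real r) = ?w powr (- of_real lam) * cnj (?w powr (- of_real lam))"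
    by (simp add: gegenbauer_gf_def)
  also have "\<dots> = of_real ((norm (?w powr (- of_real lam)))\<^sup>2)"
    by (rule complex_norm_square[symmetric])
  also have "norm (?w powr (- of_real lam)) = norm ?w powr (- lam)"
    by (subst norm_powr_real_powr') auto
  also have "(norm ?w powr (- lam))\<^sup>2 = ((norm ?w)\<^sup>2) powr (- lam)"
    by (simp add: power2_eq_square powr_mult)
  also have "(norm ?w)\<^sup>2 = 1 - 2 * Re u * r + r\<^sup>2"
  proof -
    have "(Re u)\<^sup>2 + (Im u)\<^sup>2 = 1" using assms(1) by (metis cmod_power2 one_power2)
    hence "(Re u)\<^sup>2 * r\<^sup>2 + (Im u)\<^sup>2 * r\<^sup>2 = r\<^sup>2" by (metis distrib_right mult_1)
    thus ?thesis by (simp add: cmod_power2 power2_diff power_mult_distrib)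
  qed
  finally show ?thesis .
qed

text \<open>
  The zeros of a nonzero power series are isolated.
\<close>

lemma power_series_unique_real:
  fixes c d :: "nat \<Rightarrow> real"
  assumes "\<And>r. \<bar>r\<bar> < 1 \<Longrightarrow> (\<lambda>k. c k * r ^ k) sums g r" "\<And>r. \<bar>r\<bar> < 1 \<Longrightarrow> (\<lambda>k. d k * r ^ k) sums g r"
  shows "c = d"
proof (rule ccontr)
  let ?e = "\<lambda>k. c k - d k"
  have e: "(\<lambda>k. ?e k * (r - 0) ^ k) sums 0" if "norm (r - 0) < 1" for r :: real
    using sums_diff[OF assms(1)[of r] assms(2)[of r]] that by (simp add: algebra_simps)
  assume "c \<noteq> d"
  then obtain m where m: "?e m \<noteq> 0" by auto
  have "?e 0 = 0" using e[of 0] by simp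
  hence "m > 0" using m by (cases m) auto
  obtain s where s: "0 < s" "\<And>z::real. z \<in> cball 0 s - {0} \<Longrightarrow> (0::real) \<noteq> 0"
    by (rule powser_0_nonzero[OF zero_less_one, of 0 ?e "\<lambda>_. 0"]) (use e m \<open>m > 0\<close> in auto)
  from s(2)[of s] s(1) show False by simp
qed

lemma gegenbauer_eq_circle:
  assumes "lam > 0" "norm u = 1"
  shows "of_real (gegenbauer lam l (Re u)) = gegenbauer_circle lam u l"
proof -
  let ?c = "\<lambda>l. Re (gegenbauer_circle lam u l)"
  have c: "complex_of_real (?c l) = gegenbauer_circle lam u l" for l
    using gegenbauer_circle_real[of lam u l] by (simp add: of_real_Re)
  have sums: "(\<lambda>k. ?c k * r ^ k) sums ((1 - 2 * Re u * r + r\<^sup>2) powr (- lam))" if "\<bar>r\<bar> < 1" for r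
  proof -
    have "(\<lambda>k. complex_of_real (?c k * r ^ k)) sums
            complex_of_real ((1 - 2 * Re u * r + r\<^sup>2) powr (- lam))"
      using gegenbauer_circle_sums[OF assms, of "of_real r"] that
      by (simp add: c gegenbauer_gf_real[OF assms(2)])
    thus ?thesis by (simp only: sums_of_real_iff)
  qed
  have "(THE c :: nat \<Rightarrow> real. \<forall>r. \<bar>r\<bar> < 1 \<longrightarrow>
        (\<lambda>k. c k * r ^ k) sums ((1 - 2 * Re u * r + r\<^sup>2) powr (- lam))) = ?c"
    using sums by (intro the_equality power_series_unique_real) blast+
  thus ?thesis by (simp add: gegenbauer_def c)
qed

lemma Re_circle_point:
  assumes "t \<in> {-1..1}"
  obtains u where "norm u = 1" "Re u = t"
proof
  have "t\<^sup>2 \<le> 1" using assms by (auto simp: abs_square_le_1)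
  thus "norm (Complex t (sqrt (1 - t\<^sup>2))) = 1" by (simp add: cmod_def)
qed simp

lemma abs_gegenbauer_le:
  assumes "lam > 0" "t \<in> {-1..1}"
  shows "\<bar>gegenbauer lam l t\<bar> \<le> gegenbauer lam l 1"
proof -
  obtain u where u: "norm u = 1" "Re u = t" using Re_circle_point[OF assms(2)] .
  have "\<bar>gegenbauer lam l t\<bar> = norm (complex_of_real (gegenbauer lam l t))" by simp
  also have "\<dots> \<le> Re (gegenbauer_circle lam 1 l)"
    using gegenbauer_eq_circle[OF assms(1) u(1), of l] norm_gegenbauer_circle_le[OF assms(1) u(1)] u(2)
    by simp
  also have "\<dots> = Re (complex_of_real (gegenbauer lam l 1))"
    using gegenbauer_eq_circle[OF assms(1), of 1 l] by simp
  finally show ?thesis by simp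
qed

lemma abs_gegenbauer_kernel_le:
  assumes "lam > 0" "t \<in> {-1..1}"
  shows "\<bar>gegenbauer_kernel lam l t\<bar> \<le> gegenbauer_kernel lam l 1"
  using abs_gegenbauer_le[OF assms] assms(1)
  by (simp add: gegenbauer_kernel_def abs_mult mult_left_mono divide_right_mono)

lemma poisson_kernel_sums:
  fixes z u :: complex
  assumes "lam > 0" "norm u = 1" "norm z < 1"
  shows "(\<lambda>l. of_real (gegenbauer_kernel lam l (Re u)) * z ^ l)
           sums poisson_kernel lam u z"
  using gegenbauer_circle_kernel_sums[OF assms] assms
  by (simp add: gegenbauer_kernel_def gegenbauer_eq_circle)

lemma summable_gegenbauer_kernel_1:
  assumes "lam > 0" "0 \<le> r" "r < 1"
  shows "summable (\<lambda>l. gegenbauer_kernel lam l 1 * r ^ l)"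
proof -
  have "summable (\<lambda>l. complex_of_real (gegenbauer_kernel lam l (Re 1) * r ^ l))"
    using poisson_kernel_sums[of lam 1 "of_real r"] assms 
    by (auto dest!: sums_summable)
  thus ?thesis by (simp only: summable_of_real_iff) simp
qed

text \<open>
  The generating function \<open>F\<close> satisfies \<open>(1 - 2 t X + X\<^sup>2) F' = 2 lam (t - X) F\<close>, because each
  binomial factor satisfies a first-order equation. As an identity of formal power series it
  gives the recurrence by comparing coefficients.
\<close>

lemma gegenbauer_recurrence:
  assumes "lam > 0" "t \<in> {-1..1}"
  shows "gegenbauer lam 0 t = 1" "gegenbauer lam 1 t = 2 * lam * t"
    and "(real l + 2) * gegenbauer lam (Suc (Suc l)) t
       = 2 * (real l + 1 + lam) * t * gegenbauer lam (Suc l) t - (real l + 2 * lam) * gegenbauer lam l t"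
proof -
  obtain u where u: "norm u = 1" "Re u = t" using Re_circle_point[OF assms(2)] .
  have tu: "u + cnj u = 2 * of_real t" using u(2) complex_add_cnj[of u] by simp
  have uu: "u * cnj u = 1" using u(1) complex_norm_square[of u] by simp
  note eq = gegenbauer_eq_circle[OF assms(1) u(1), unfolded u(2)]
  have "complex_of_real (gegenbauer lam 0 t) = of_real 1"
    unfolding eq by (simp add: gegenbauer_circle_def neg_binomial_coeff_def)
  thus "gegenbauer lam 0 t = 1" by (simp only: of_real_eq_iff)
  have "complex_of_real (gegenbauer lam 1 t) = of_real lam * (u + cnj u)"
    unfolding eq by (simp add: gegenbauer_circle_def neg_binomial_coeff_def algebra_simps)
  also have "\<dots> = of_real (2 * lam * t)" unfolding tu by simp
  finally show "gegenbauer lam 1 t = 2 * lam * t" by (simp only: of_real_eq_iff)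
  define A where "A v = Abs_fps (\<lambda>k. of_real (neg_binomial_coeff lam k) * v ^ k :: complex)" for v
  define F where "F = A u * A (cnj u)"
  have F_nth: "fps_nth F l = of_real (gegenbauer lam l t)" for l
    unfolding eq F_def A_def by (simp add: fps_mult_nth gegenbauer_circle_def atMost_atLeast0)
  have A: "fps_deriv (A v) * (1 - fps_const v * fps_X) = fps_const (of_real lam * v) * A v" for v
  proof (rule fps_ext)
    fix k
    have nth: "fps_nth (fps_deriv (A v)) j = v * (of_real ((lam + real j) * neg_binomial_coeff lam j) * v ^ j)" for j
    proof -
      have "fps_nth (fps_deriv (A v)) j
          = of_real (real (Suc j) * neg_binomial_coeff lam (Suc j)) * v ^ Suc j"
        by (simp add: A_def)
      thus ?thesis unfolding neg_binomial_coeff_Suc by simp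
    qed
    show "fps_nth (fps_deriv (A v) * (1 - fps_const v * fps_X)) k = fps_nth (fps_const (of_real lam * v) * A v) k"
    proof (cases k)
      case 0
      thus ?thesis using nth[of 0] by (simp add: A_def)
    next
      case (Suc j)
      have "fps_nth (fps_deriv (A v) * (1 - fps_const v * fps_X)) k
         = fps_nth (fps_deriv (A v)) k - v * fps_nth (fps_deriv (A v)) j"
        unfolding Suc by (simp only: right_diff_distrib mult_1_right fps_sub_nth
             mult.left_commute[of "fps_deriv (A v)"] fps_mult_left_const_nth fps_mult_fps_X_commute fps_X_mult_nth) simp
      also have "v * fps_nth (fps_deriv (A v)) j
          = v * (of_real (real (Suc j)) * (of_real (neg_binomial_coeff lam (Suc j)) * v ^ Suc j))"
        by (simp add: A_def)
      finally show ?thesis unfolding nth Suc by (simp add: A_def algebra_simps)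
    qed
  qed
  have B: "fps_deriv F * (1 - fps_const (2 * of_real t) * fps_X + fps_X * fps_X)
     = fps_const (2 * of_real lam) * (fps_const (of_real t) - fps_X) * F"
  proof -
    let ?U = "fps_const u" and ?V = "fps_const (cnj u)"
    have "?U + ?V = fps_const (2 * of_real t)" using tu by simp
    have q: "1 - fps_const (2 * of_real t) * fps_X + fps_X * fps_X
       = (1 - ?U * fps_X) * (1 - ?V * fps_X)"
    proof -
      have "(1 - ?U * fps_X) * (1 - ?V * fps_X) = 1 - (?U + ?V) * fps_X + (?U * ?V) * (fps_X * fps_X)"
        by (simp only: algebra_simps mult_1_left mult_1_right)
      thus ?thesis using tu uu by simp
    qed
    have "fps_deriv F * ((1 - ?U * fps_X) * (1 - ?V * fps_X))
        = (fps_deriv (A u) * (1 - ?U * fps_X)) * ((1 - ?V * fps_X) * A (cnj u))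
          + (fps_deriv (A (cnj u)) * (1 - ?V * fps_X)) * ((1 - ?U * fps_X) * A u)"
      unfolding F_def fps_deriv_mult by (simp only: algebra_simps)
    also have "\<dots> = fps_const (of_real lam) * (?U + ?V - 2 * (?U * ?V) * fps_X) * F"
      unfolding A F_def fps_const_mult[symmetric]
      by (simp only: algebra_simps mult_1_left mult_1_right mult_2 mult_2_right)
    also have "\<dots> = fps_const (2 * of_real lam) * (fps_const (of_real t) - fps_X) * F"
      using tu uu by (simp add: algebra_simps fps_const_mult[symmetric] numeral_fps_const del: fps_const_mult)
    finally show ?thesis unfolding q .
  qed
  have "fps_nth (fps_deriv F * (1 - fps_const (2 * of_real t) * fps_X + fps_X * fps_X)) (Suc l)
     = fps_nth (fps_deriv F) (Suc l) - 2 * of_real t * fps_nth (fps_deriv F) l 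
       + fps_nth (fps_X * fps_deriv F) l"
  proof -
    have "fps_deriv F * (1 - fps_const (2 * of_real t) * fps_X + fps_X * fps_X)
      = fps_deriv F - fps_const (2 * of_real t) * (fps_X * fps_deriv F) + fps_X * (fps_X * fps_deriv F)"
      by (simp only: algebra_simps mult_1_left mult_1_right)
    thus ?thesis by (simp only: fps_sub_nth fps_add_nth fps_mult_left_const_nth fps_X_mult_nth) simp
  qed
  also have "fps_nth (fps_X * fps_deriv F) l = of_nat l * fps_nth F l"
    by (cases l) simp_all
  finally have L: "fps_nth (fps_deriv F * (1 - fps_const (2 * of_real t) * fps_X + fps_X * fps_X)) (Suc l)
     = of_real ((real l + 2) * gegenbauer lam (Suc (Suc l)) t
          - 2 * t * ((real l + 1) * gegenbauer lam (Suc l) t) + real l * gegenbauer lam l t)"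
    by (simp add: F_nth algebra_simps)
  have R: "fps_nth (fps_const (2 * of_real lam) * (fps_const (of_real t) - fps_X) * F) (Suc l)
      = of_real (2 * lam * (t * gegenbauer lam (Suc l) t - gegenbauer lam l t))"
    by (simp add: F_nth mult.assoc left_diff_distrib)
  have "(real l + 2) * gegenbauer lam (Suc (Suc l)) t
          - 2 * t * ((real l + 1) * gegenbauer lam (Suc l) t) + real l * gegenbauer lam l t
       = 2 * lam * (t * gegenbauer lam (Suc l) t - gegenbauer lam l t)"
    using L R unfolding B by (simp only: of_real_eq_iff)
  thus "(real l + 2) * gegenbauer lam (Suc (Suc l)) t
       = 2 * (real l + 1 + lam) * t * gegenbauer lam (Suc l) t - (real l + 2 * lam) * gegenbauer lam l t"
    by (simp add: algebra_simps)
qed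

section \<open>The Gegenbauer differential equation\<close>

text \<open>
  The generating function determines the Gegenbauer polynomials on \<open>[-1, 1]\<close> only. This
  polynomial agrees with them there and can be differentiated formally.
\<close>

fun gegenbauer_poly :: "real \<Rightarrow> nat \<Rightarrow> real poly" where
  "gegenbauer_poly lam 0 = 1"
| "gegenbauer_poly lam (Suc 0) = [:0, 2 * lam:]"
| "gegenbauer_poly lam (Suc (Suc l)) = smult (1 / (real l + 2))
     (smult (2 * (real l + 1 + lam)) (pCons 0 (gegenbauer_poly lam (Suc l)))
      - smult (real l + 2 * lam) (gegenbauer_poly lam l))"

lemma poly_gegenbauer_poly:
  assumes "lam > 0" "t \<in> {-1..1}"
  shows "poly (gegenbauer_poly lam l) t = gegenbauer lam l t"
  using assms
proof (induction lam l rule: gegenbauer_poly.induct)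
  case (3 lam l)
  have "(real l + 2) * poly (gegenbauer_poly lam (Suc (Suc l))) t
      = (real l + 2) * gegenbauer lam (Suc (Suc l)) t"
    unfolding gegenbauer_recurrence(3)[OF 3(3,4)] 3(1)[OF 3(3,4), symmetric] 3(2)[OF 3(3,4), symmetric]
    by simp
  thus ?case by (subst (asm) mult_cancel_left) auto
qed (use gegenbauer_recurrence in auto)

lemma gegenbauer_poly_Suc_Suc:
  fixes lam x :: real and l :: nat
  defines "p \<equiv> \<lambda>l. poly (gegenbauer_poly lam l) x" and "d \<equiv> \<lambda>l. poly (pderiv (gegenbauer_poly lam l)) x"
  shows "(real l + 2) * p (Suc (Suc l)) = 2 * (real l + 1 + lam) * x * p (Suc l) - (real l + 2 * lam) * p l"
    and "(real l + 2) * d (Suc (Suc l))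
           = 2 * (real l + 1 + lam) * (p (Suc l) + x * d (Suc l)) - (real l + 2 * lam) * d l"
  by (simp_all add: p_def d_def pderiv_smult pderiv_diff pderiv_pCons distrib_left)

text \<open>
  The two relations, taken for the same derivative, are equivalent modulo the recurrence. The
  induction carries both, since the recurrence for degree \<open>l + 2\<close> involves the derivatives in
  degrees \<open>l + 1\<close> and \<open>l\<close>.
\<close>

lemma gegenbauer_poly_ladder:
  fixes lam x :: real and l :: nat
  defines "p \<equiv> \<lambda>l. poly (gegenbauer_poly lam l) x" and "d \<equiv> \<lambda>l. poly (pderiv (gegenbauer_poly lam l)) x"
  shows "(1 - x\<^sup>2) * d (Suc l) = - (real l + 1) * x * p (Suc l) + (real l + 2 * lam) * p l"
    and "(1 - x\<^sup>2) * d l = (real l + 2 * lam) * x * p l - (real l + 1) * p (Suc l)"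
proof -
  have "(1 - x\<^sup>2) * d (Suc l) = - (real l + 1) * x * p (Suc l) + (real l + 2 * lam) * p l \<and>
    (1 - x\<^sup>2) * d l = (real l + 2 * lam) * x * p l - (real l + 1) * p (Suc l)"
  proof (induction l)
    case 0
    show ?case by (simp add: p_def d_def pderiv_pCons power2_eq_square algebra_simps)
  next
    case (Suc l)
    have R: "(real l + 2) * p (Suc (Suc l)) = 2 * (real l + 1 + lam) * x * p (Suc l) - (real l + 2 * lam) * p l"
      "(real l + 2) * d (Suc (Suc l))
         = 2 * (real l + 1 + lam) * (p (Suc l) + x * d (Suc l)) - (real l + 2 * lam) * d l"
      unfolding p_def d_def by (rule gegenbauer_poly_Suc_Suc)+
    let ?c = "real l + 2"
    have "?c * ((1 - x\<^sup>2) * d (Suc (Suc l))) = (1 - x\<^sup>2) * (?c * d (Suc (Suc l)))" by simp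
    also have "\<dots> = 2 * (real l + 1 + lam) * ((1 - x\<^sup>2) * p (Suc l) + x * ((1 - x\<^sup>2) * d (Suc l)))
        - (real l + 2 * lam) * ((1 - x\<^sup>2) * d l)"
      unfolding R by algebra
    also have "\<dots> = - (real l + 2) * x * (2 * (real l + 1 + lam) * x * p (Suc l) - (real l + 2 * lam) * p l)
        + ?c * (real l + 1 + 2 * lam) * p (Suc l)"
      unfolding Suc.IH[THEN conjunct1] Suc.IH[THEN conjunct2] by algebra
    also have "\<dots> = ?c * (- (real l + 2) * x * p (Suc (Suc l)) + (real l + 1 + 2 * lam) * p (Suc l))"
      unfolding R(1)[symmetric] by (simp only: algebra_simps)
    finally have "(1 - x\<^sup>2) * d (Suc (Suc l))
        = - (real l + 2) * x * p (Suc (Suc l)) + (real l + 1 + 2 * lam) * p (Suc l)"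
      by (subst (asm) mult_cancel_left) auto
    moreover have "(1 - x\<^sup>2) * d (Suc l) = (real l + 1 + 2 * lam) * x * p (Suc l) - ?c * p (Suc (Suc l))"
      unfolding Suc.IH[THEN conjunct1] R(1) by algebra
    ultimately show ?case by (simp add: add_ac)
  qed
  thus "(1 - x\<^sup>2) * d (Suc l) = - (real l + 1) * x * p (Suc l) + (real l + 2 * lam) * p l"
    and "(1 - x\<^sup>2) * d l = (real l + 2 * lam) * x * p l - (real l + 1) * p (Suc l)"
    by blast+
qed

text \<open>
  Differentiating the first ladder relation leaves the derivative of the polynomial of lower
  degree, which the two ladder relations express through the polynomial of degree \<open>l\<close>; this
  elimination divides by \<open>1 - x\<^sup>2\<close>.
\<close>

lemma gegenbauer_poly_ode:
  fixes lam x :: real and l :: nat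
  defines "P \<equiv> gegenbauer_poly lam l"
  assumes "\<bar>x\<bar> < 1"
  shows "(1 - x\<^sup>2) * poly (pderiv (pderiv P)) x
    = (2 * lam + 1) * x * poly (pderiv P) x - real l * (real l + 2 * lam) * poly P x"
proof (cases l)
  case 0
  thus ?thesis by (simp add: P_def)
next
  case (Suc j)
  let ?Q = "gegenbauer_poly lam j"
  have x: "1 - x\<^sup>2 \<noteq> 0" using assms(2) abs_square_less_1[of x] by linarith
  have PQ: "[:1, 0, -1:] * pderiv P = smult (- (real j + 1)) (pCons 0 P) + smult (real j + 2 * lam) ?Q"
  proof (subst poly_eq_poly_eq_iff[symmetric], rule ext)
    fix y
    show "poly ([:1, 0, -1:] * pderiv P) y
        = poly (smult (- (real j + 1)) (pCons 0 P) + smult (real j + 2 * lam) ?Q) y"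
      using gegenbauer_poly_ladder(1)[of y lam j] unfolding P_def Suc
      by (simp add: power2_eq_square algebra_simps)
  qed
  have "poly (pderiv ([:1, 0, -1:] * pderiv P)) x
      = (1 - x\<^sup>2) * poly (pderiv (pderiv P)) x - 2 * x * poly (pderiv P) x"
    by (simp add: pderiv_mult pderiv_pCons pderiv_add pderiv_minus power2_eq_square algebra_simps)
  moreover have "poly (pderiv (smult (- (real j + 1)) (pCons 0 P) + smult (real j + 2 * lam) ?Q)) x
      = - (real j + 1) * (poly P x + x * poly (pderiv P) x) + (real j + 2 * lam) * poly (pderiv ?Q) x"
    by (simp add: pderiv_add pderiv_smult pderiv_pCons pderiv_minus algebra_simps)
  moreover have "poly (pderiv ?Q) x = x * poly (pderiv P) x - (real j + 1) * poly P x"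
  proof -
    have "(1 - x\<^sup>2) * poly (pderiv ?Q) x
        = (real j + 2 * lam) * x * poly ?Q x - (real j + 1) * poly P x"
      using gegenbauer_poly_ladder(2)[of x lam j] by (simp add: P_def Suc)
    also have "\<dots> = x * ((1 - x\<^sup>2) * poly (pderiv P) x) - (1 - x\<^sup>2) * ((real j + 1) * poly P x)"
      using gegenbauer_poly_ladder(1)[of x lam j] unfolding P_def Suc by algebra
    also have "\<dots> = (1 - x\<^sup>2) * (x * poly (pderiv P) x - (real j + 1) * poly P x)" by algebra
    finally show ?thesis using x by simp
  qed
  ultimately have "(1 - x\<^sup>2) * poly (pderiv (pderiv P)) x - 2 * x * poly (pderiv P) x
     = - (real j + 1) * (poly P x + x * poly (pderiv P) x)
       + (real j + 2 * lam) * (x * poly (pderiv P) x - (real j + 1) * poly P x)"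
    unfolding PQ by simp
  thus ?thesis by (simp add: Suc algebra_simps)
qed

section \<open>Orthogonality and uniqueness of Gegenbauer expansions\<close>

lemma gegenbauer_weight_bounds:
  assumes "lam \<ge> 1/2" "t \<in> {-1..1}"
  shows "0 \<le> gegenbauer_weight lam t" "gegenbauer_weight lam t \<le> 1"
proof -
  show "0 \<le> gegenbauer_weight lam t" by (simp add: gegenbauer_weight_def)
  have "t\<^sup>2 \<le> 1" using assms(2) by (auto simp: abs_square_le_1)
  thus "gegenbauer_weight lam t \<le> 1"
    unfolding gegenbauer_weight_def using assms(1) by (intro powr_le1) auto
qed

lemma gegenbauer_weight_measurable [measurable]: "gegenbauer_weight lam \<in> borel_measurable borel"
  unfolding gegenbauer_weight_def[abs_def] by measurable

lemma set_integrable_times_weight: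
  fixes f :: "real \<Rightarrow> real"
  assumes "lam \<ge> 1/2" "continuous_on {-1..1} f"
  shows "set_integrable lborel {-1..1} (\<lambda>t. f t * gegenbauer_weight lam t)"
proof -
  have "set_integrable lborel {-1..1} f"
    unfolding set_integrable_def by (intro borel_integrable_compact assms) auto
  thus ?thesis
  proof (rule set_integrable_bound)
    have "(\<lambda>t. indicator {-1..1} t *\<^sub>R f t) \<in> borel_measurable borel"
      using assms(2) by (intro borel_measurable_continuous_on_indicator) auto
    hence "(\<lambda>t. (indicator {-1..1} t *\<^sub>R f t) * gegenbauer_weight lam t) \<in> borel_measurable borel"
      by measurable
    thus "set_borel_measurable lborel {-1..1} (\<lambda>t. f t * gegenbauer_weight lam t)"
      by (simp add: set_borel_measurable_def mult.assoc)
    show "AE x in lborel. x \<in> {-1..1} \<longrightarrow> norm (f x * gegenbauer_weight lam x) \<le> norm (f x)"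
      using gegenbauer_weight_bounds[OF assms(1)]
      by (intro AE_I2) (auto simp: abs_mult mult_left_le)
  qed
qed

text \<open>
  By the differential equation, the weighted Wronskian \<open>V\<close> of two Gegenbauer polynomials has
  as derivative a multiple of their weighted product, and \<open>V\<close> vanishes at both endpoints. The
  multiple is the difference of the eigenvalues \<open>l (l + 2 lam)\<close>, which are distinct.
\<close>

lemma gegenbauer_orthogonal:
  assumes "lam \<ge> 1/2" "j \<noteq> k"
  shows "(LINT t:{-1..1}|lborel. gegenbauer lam j t * gegenbauer lam k t * gegenbauer_weight lam t) = 0"
proof -
  define p q where "p = gegenbauer_poly lam j" and "q = gegenbauer_poly lam k"
  define D where "D = pderiv p * q - p * pderiv q"
  define ev :: "nat \<Rightarrow> real" where "ev l = real l * (real l + 2 * lam)" for l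
  let ?V = "\<lambda>t. (1 - t\<^sup>2) powr (lam + 1/2) * poly D t"
  let ?f = "\<lambda>t. poly p t * poly q t * gegenbauer_weight lam t"
  have pos: "lam > 0" using assms(1) by simp
  have "((\<lambda>t. (ev k - ev j) * ?f t) has_integral (?V 1 - ?V (-1))) {-1..1}"
  proof (rule fundamental_theorem_of_calculus_interior)
    show "continuous_on {-1..1} ?V"
      using assms(1) by (intro continuous_intros continuous_on_powr') (auto simp: abs_square_le_1)
    fix t :: real assume t: "t \<in> {-1<..<1}"
    have t2: "1 - t\<^sup>2 > 0" using t by (simp add: abs_square_less_1 abs_less_iff)
    have w: "(1 - t\<^sup>2) powr (lam + 1/2) = (1 - t\<^sup>2) * gegenbauer_weight lam t"
    proof -
      have "lam + 1/2 = 1 + (lam - 1/2)" by simp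
      thus ?thesis using t2 unfolding gegenbauer_weight_def by (simp only: powr_add powr_one)
    qed
    have "(?V has_real_derivative
       (lam + 1/2) * (1 - t\<^sup>2) powr (lam + 1/2 - 1) * (- 2 * t) * poly D t
       + (1 - t\<^sup>2) powr (lam + 1/2) * poly (pderiv D) t) (at t)"
      using t2 by (auto intro!: derivative_eq_intros poly_DERIV simp: powr_diff field_simps)
    also have "(lam + 1/2) * (1 - t\<^sup>2) powr (lam + 1/2 - 1) * (- 2 * t) * poly D t
       + (1 - t\<^sup>2) powr (lam + 1/2) * poly (pderiv D) t
       = gegenbauer_weight lam t * (- (2 * lam + 1) * t * poly D t + (1 - t\<^sup>2) * poly (pderiv D) t)"
      unfolding w by (simp add: gegenbauer_weight_def algebra_simps)
    also have "(1 - t\<^sup>2) * poly (pderiv D) t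
        = ((1 - t\<^sup>2) * poly (pderiv (pderiv p)) t) * poly q t - poly p t * ((1 - t\<^sup>2) * poly (pderiv (pderiv q)) t)"
      by (simp add: D_def pderiv_mult pderiv_diff algebra_simps)
    also have "- (2 * lam + 1) * t * poly D t + \<dots> = (ev k - ev j) * (poly p t * poly q t)"
    proof -
      have "\<bar>t\<bar> < 1" using t by auto
      note ode = gegenbauer_poly_ode[OF this, of lam j, folded p_def]
        gegenbauer_poly_ode[OF this, of lam k, folded q_def]
      show ?thesis unfolding ode by (simp add: D_def ev_def algebra_simps)
    qed
    finally show "(?V has_vector_derivative (ev k - ev j) * ?f t) (at t)"
      by (simp add: has_real_derivative_iff_has_vector_derivative mult_ac)
  qed simp
  hence "((\<lambda>t. (ev k - ev j) * ?f t) has_integral 0) {-1..1}" using assms(1) by simp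
  moreover have "ev k \<noteq> ev j"
  proof
    assume "ev k = ev j"
    hence "(real k - real j) * (real k + real j + 2 * lam) = 0" by (simp add: ev_def algebra_simps)
    thus False using assms pos by auto
  qed
  ultimately have "integral {-1..1} ?f = 0"
    by (auto dest!: integral_unique)
  moreover have "(LINT t:{-1..1}|lborel. ?f t) = integral {-1..1} ?f"
    using assms(1) by (intro set_borel_integral_eq_integral set_integrable_times_weight continuous_intros)
  moreover have "(LINT t:{-1..1}|lborel. gegenbauer lam j t * gegenbauer lam k t * gegenbauer_weight lam t)
      = (LINT t:{-1..1}|lborel. ?f t)"
    using poly_gegenbauer_poly[OF pos] by (intro set_lebesgue_integral_cong) (auto simp: p_def q_def)
  ultimately show ?thesis by simp
qed

lemma gegenbauer_1_pos:
  assumes "lam > 0"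
  shows "gegenbauer lam l 1 > 0"
proof -
  have "complex_of_real (gegenbauer lam l 1)
      = of_real (\<Sum>k\<le>l. neg_binomial_coeff lam k * neg_binomial_coeff lam (l - k))"
    using gegenbauer_eq_circle[OF assms, of 1 l] by (simp add: gegenbauer_circle_def)
  hence "gegenbauer lam l 1 = (\<Sum>k\<le>l. neg_binomial_coeff lam k * neg_binomial_coeff lam (l - k))"
    by (simp only: of_real_eq_iff)
  also have "\<dots> > 0" using neg_binomial_coeff_pos[OF assms] by (intro sum_pos) auto
  finally show ?thesis .
qed

lemma gegenbauer_norm_pos:
  assumes "lam \<ge> 1/2"
  shows "(LINT t:{-1..1}|lborel. (gegenbauer lam l t)\<^sup>2 * gegenbauer_weight lam t) > 0"
proof -
  let ?P = "gegenbauer_poly lam l"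
  let ?f = "\<lambda>t. (poly ?P t)\<^sup>2 * gegenbauer_weight lam t"
  have pos: "lam > 0" using assms by simp
  have "poly ?P 1 \<noteq> 0"
    using gegenbauer_1_pos[OF pos, of l] poly_gegenbauer_poly[OF pos, of 1 l] by simp
  hence "?P \<noteq> 0" by auto
  have int: "integrable lborel (\<lambda>t. indicator {-1..1} t *\<^sub>R ?f t)"
    unfolding set_integrable_def[symmetric]
    by (intro set_integrable_times_weight assms continuous_intros)
  have nonneg: "indicator {-1..1} t *\<^sub>R ?f t \<ge> 0" for t
    using gegenbauer_weight_bounds(1)[OF assms, of t] by (auto simp: indicator_def)
  have "(LINT t:{-1..1}|lborel. ?f t) \<noteq> 0"
  proof
    assume "(LINT t:{-1..1}|lborel. ?f t) = 0"
    hence "AE t in lborel. indicator {-1..1} t *\<^sub>R ?f t = 0"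
      using integral_nonneg_eq_0_iff_AE[OF int] nonneg by (simp add: set_lebesgue_integral_def)
    moreover have "AE t in lborel. t \<notin> {t. poly ?P t = 0}"
      using poly_roots_finite[OF \<open>?P \<noteq> 0\<close>] 
      by (intro AE_not_in finite_imp_null_set_lborel)
    ultimately have "AE t in lborel. t \<notin> {-1<..<1::real}"
    proof eventually_elim
      case (elim t)
      show ?case
      proof
        assume t: "t \<in> {-1<..<1}"
        hence "t\<^sup>2 < 1" by (simp add: abs_square_less_1 abs_less_iff)
        thus False using elim t by (auto simp: gegenbauer_weight_def)
      qed
    qed
    hence "emeasure lborel {-1<..<1::real} = 0"
      by (subst (asm) AE_iff_measurable[of "{-1<..<1::real}"]) auto
    thus False by simp
  qed
  moreover have "(LINT t:{-1..1}|lborel. ?f t) \<ge> 0"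
    unfolding set_lebesgue_integral_def using nonneg by (intro Bochner_Integration.integral_nonneg) auto
  moreover have "(LINT t:{-1..1}|lborel. (gegenbauer lam l t)\<^sup>2 * gegenbauer_weight lam t)
      = (LINT t:{-1..1}|lborel. ?f t)"
    using poly_gegenbauer_poly[OF pos] by (intro set_lebesgue_integral_cong) auto
  ultimately show ?thesis by simp
qed

lemma continuous_on_gegenbauer:
  assumes "lam > 0"
  shows "continuous_on {-1..1} (gegenbauer lam l)"
proof -
  have "continuous_on {-1..1} (poly (gegenbauer_poly lam l))" by (intro continuous_intros)
  thus ?thesis using poly_gegenbauer_poly[OF assms] by (subst continuous_on_cong[OF refl]) auto
qed

text \<open>
  If \<open>d\<close> is the difference of two coefficient sequences for \<open>f\<close>, the partial sums with
  coefficients \<open>d\<close> tend to 0 in the weighted \<open>L\<^sup>2\<close> norm. By orthogonality their squared norm is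
  a sum of nonnegative terms that contains \<open>d\<^sub>k\<^sup>2 h\<^sub>k\<close> as soon as \<open>N > k\<close>, where
  \<open>h\<^sub>k > 0\<close> is the squared norm of the polynomial of degree \<open>k\<close>.
\<close>

lemma gegenbauer_expansion_unique:
  assumes "lam \<ge> 1/2" "gegenbauer_expansion lam f c" "gegenbauer_expansion lam f c'"
  shows "c = c'"
proof
  fix k
  let ?w = "gegenbauer_weight lam" and ?C = "gegenbauer lam"
  define d where "d l = c l - c' l" for l
  define h where "h l = (LINT t:{-1..1}|lborel. (?C l t)\<^sup>2 * ?w t)" for l
  have pos: "lam > 0" using assms(1) by simp
  define S where "S b N t = (\<Sum>l<N. b l * ?C l t)" for b :: "nat \<Rightarrow> real" and N t
  note cont = continuous_on_gegenbauer[OF pos]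
  have contS: "continuous_on {-1..1} (S b N)" for b N
    unfolding S_def by (intro continuous_intros cont)
  have int: "set_integrable lborel {-1..1} (\<lambda>t. (f t - S b N t)\<^sup>2 * ?w t)"
    if "b \<in> {c, c'}" for b N
    using assms(2,3) that unfolding gegenbauer_expansion_def S_def by auto
  have lim: "(\<lambda>N. LINT t:{-1..1}|lborel. (f t - S b N t)\<^sup>2 * ?w t) \<longlonglongrightarrow> 0"
    if "b \<in> {c, c'}" for b
    using assms(2,3) that unfolding gegenbauer_expansion_def S_def by auto
  have norm_eq: "(LINT t:{-1..1}|lborel. (S d N t)\<^sup>2 * ?w t) = (\<Sum>l<N. (d l)\<^sup>2 * h l)" for N
  proof -
    have "(LINT t:{-1..1}|lborel. (S d N t)\<^sup>2 * ?w t)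
        = (LINT t:{-1..1}|lborel. \<Sum>i<N. \<Sum>j<N. d i * d j * (?C i t * ?C j t * ?w t))"
      by (intro set_lebesgue_integral_cong)
         (auto simp: S_def power2_eq_square sum_product sum_distrib_left sum_distrib_right mult_ac)
    also have "\<dots> = (\<Sum>i<N. \<Sum>j<N. d i * d j * (LINT t:{-1..1}|lborel. ?C i t * ?C j t * ?w t))"
    proof -
      have I: "set_integrable lborel {-1..1} (\<lambda>t. ?C i t * ?C j t * ?w t)" for i j
        by (intro set_integrable_times_weight assms continuous_intros cont)
      show ?thesis
        using I unfolding set_integrable_def set_lebesgue_integral_def
        by (simp add: sum_distrib_left mult.left_commute[of "indicator {-1..1} _"])
    qed
    also have "\<dots> = (\<Sum>i<N. \<Sum>j<N. if j = i then (d i)\<^sup>2 * h i else 0)"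
      using gegenbauer_orthogonal[OF assms(1)]
      by (intro sum.cong refl) (auto simp: h_def power2_eq_square)
    finally show ?thesis by simp
  qed
  have upper: "(LINT t:{-1..1}|lborel. (S d N t)\<^sup>2 * ?w t)
      \<le> 2 * (LINT t:{-1..1}|lborel. (f t - S c N t)\<^sup>2 * ?w t)
        + 2 * (LINT t:{-1..1}|lborel. (f t - S c' N t)\<^sup>2 * ?w t)" for N
  proof -
    have "(LINT t:{-1..1}|lborel. (S d N t)\<^sup>2 * ?w t)
      \<le> (LINT t:{-1..1}|lborel. 2 * ((f t - S c N t)\<^sup>2 * ?w t) + 2 * ((f t - S c' N t)\<^sup>2 * ?w t))"
    proof (rule set_integral_mono)
      show "set_integrable lborel {-1..1} (\<lambda>t. (S d N t)\<^sup>2 * ?w t)"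
        by (intro set_integrable_times_weight assms continuous_intros contS)
      show "set_integrable lborel {-1..1}
         (\<lambda>t. 2 * ((f t - S c N t)\<^sup>2 * ?w t) + 2 * ((f t - S c' N t)\<^sup>2 * ?w t))"
        using int by (intro set_integral_add set_integrable_mult_right) auto
      fix t :: real assume t: "t \<in> {-1..1}"
      have eq: "S d N t = (f t - S c' N t) - (f t - S c N t)"
        by (simp add: S_def d_def algebra_simps sum_subtractf)
      have "(x - y)\<^sup>2 \<le> 2 * y\<^sup>2 + 2 * x\<^sup>2" for x y :: real
        using zero_le_power2[of "x + y"] by (simp add: power2_eq_square algebra_simps)
      hence "(S d N t)\<^sup>2 \<le> 2 * (f t - S c N t)\<^sup>2 + 2 * (f t - S c' N t)\<^sup>2"
        unfolding eq .
      from mult_right_mono[OF this gegenbauer_weight_bounds(1)[OF assms(1) t]]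
      show "(S d N t)\<^sup>2 * ?w t \<le> 2 * ((f t - S c N t)\<^sup>2 * ?w t) + 2 * ((f t - S c' N t)\<^sup>2 * ?w t)"
        by (simp add: algebra_simps)
    qed
    also have "\<dots> = 2 * (LINT t:{-1..1}|lborel. (f t - S c N t)\<^sup>2 * ?w t)
        + 2 * (LINT t:{-1..1}|lborel. (f t - S c' N t)\<^sup>2 * ?w t)"
      using int by (subst set_integral_add(2)) auto
    finally show ?thesis .
  qed
  have hpos: "h l > 0" for l unfolding h_def by (rule gegenbauer_norm_pos[OF assms(1)])
  have "(d k)\<^sup>2 * h k \<le> 0"
  proof (rule tendsto_lowerbound)
    show "(\<lambda>N. 2 * (LINT t:{-1..1}|lborel. (f t - S c N t)\<^sup>2 * ?w t)
        + 2 * (LINT t:{-1..1}|lborel. (f t - S c' N t)\<^sup>2 * ?w t)) \<longlonglongrightarrow> 0"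
      using tendsto_add[OF tendsto_mult_left[OF lim[of c], of 2] tendsto_mult_left[OF lim[of c'], of 2]]
      by simp
    show "\<forall>\<^sub>F N in sequentially. (d k)\<^sup>2 * h k \<le> 2 * (LINT t:{-1..1}|lborel. (f t - S c N t)\<^sup>2 * ?w t)
        + 2 * (LINT t:{-1..1}|lborel. (f t - S c' N t)\<^sup>2 * ?w t)"
      using eventually_gt_at_top[of k]
    proof eventually_elim
      case (elim N)
      have "(d k)\<^sup>2 * h k \<le> (\<Sum>l<N. (d l)\<^sup>2 * h l)"
        using elim hpos by (intro member_le_sum) (auto simp: less_imp_le)
      thus ?case using upper[of N] norm_eq[of N] by linarith
    qed
  qed auto
  hence "d k = 0" using hpos[of k] by (simp add: mult_le_0_iff)
  thus "c k = c' k" by (simp add: d_def)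
qed

section \<open>Series in the reproducing kernels\<close>

definition kernel_series :: "real \<Rightarrow> (nat \<Rightarrow> real) \<Rightarrow> real \<Rightarrow> real" where
  "kernel_series lam s t = (\<Sum>l. s l * gegenbauer_kernel lam l t)"

text \<open>
  The kernels attain their largest modulus on \<open>[-1, 1]\<close> at 1, so this is the condition of the
  Weierstrass M-test.
\<close>

definition kernel_summable :: "real \<Rightarrow> (nat \<Rightarrow> real) \<Rightarrow> bool" where
  "kernel_summable lam s \<longleftrightarrow> summable (\<lambda>l. \<bar>s l\<bar> * gegenbauer_kernel lam l 1)"

lemma gegenbauer_kernel_0: "lam > 0 \<Longrightarrow> t \<in> {-1..1} \<Longrightarrow> gegenbauer_kernel lam 0 t = 1"
  by (simp add: gegenbauer_kernel_def gegenbauer_recurrence)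

lemma gegenbauer_kernel_1_nonneg: "lam > 0 \<Longrightarrow> gegenbauer_kernel lam l 1 \<ge> 0"
  using abs_gegenbauer_kernel_le[of lam 1 l] by simp

text \<open>
  The kernels at 1 are the coefficients of a power series of radius of convergence 1. Hence
  exponential decay of the coefficients, at any rate, ensures summability.
\<close>

lemma kernel_summable_exp_bound:
  assumes "lam > 0" "b > 0" "\<And>l. \<bar>s l\<bar> \<le> D * exp (- (b * real l))"
  shows "kernel_summable lam s"
proof -
  have "summable (\<lambda>l. D * (gegenbauer_kernel lam l 1 * exp (- b) ^ l))"
    using assms by (intro summable_mult summable_gegenbauer_kernel_1) auto
  moreover have "norm (\<bar>s l\<bar> * gegenbauer_kernel lam l 1) \<le> D * (gegenbauer_kernel lam l 1 * exp (- b) ^ l)" for l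
    using mult_right_mono[OF assms(3)[of l] gegenbauer_kernel_1_nonneg[OF assms(1), of l]]
      gegenbauer_kernel_1_nonneg[OF assms(1), of l]
    by (simp add: mult_ac flip: exp_of_nat_mult)
  ultimately show ?thesis
    unfolding kernel_summable_def by (blast intro: summable_comparison_test')
qed

lemma kernel_term_le:
  assumes "lam > 0" "t \<in> {-1..1}"
  shows "\<bar>s l * gegenbauer_kernel lam l t\<bar> \<le> \<bar>s l\<bar> * gegenbauer_kernel lam l 1"
  using abs_gegenbauer_kernel_le[OF assms] by (simp add: abs_mult mult_left_mono)

lemma kernel_series_summable:
  assumes "lam > 0" "kernel_summable lam s" "t \<in> {-1..1}"
  shows "summable (\<lambda>l. \<bar>s l * gegenbauer_kernel lam l t\<bar>)"
  using assms(2) unfolding kernel_summable_def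
  by (rule summable_comparison_test'[of _ 0]) (simp add: kernel_term_le[OF assms(1,3)])

lemma kernel_series_sums:
  assumes "lam > 0" "kernel_summable lam s" "t \<in> {-1..1}"
  shows "(\<lambda>l. s l * gegenbauer_kernel lam l t) sums kernel_series lam s t"
  unfolding kernel_series_def
  using kernel_series_summable[OF assms] by (intro summable_sums) (rule summable_rabs_cancel)

lemma uniform_limit_kernel_series:
  assumes "lam > 0" "kernel_summable lam s"
  shows "uniform_limit {-1..1} (\<lambda>N t. \<Sum>l<N. s l * gegenbauer_kernel lam l t)
           (kernel_series lam s) sequentially"
  unfolding kernel_series_def
  using assms(2) kernel_term_le[OF assms(1)] unfolding kernel_summable_def
  by (intro Weierstrass_m_test) auto

lemma continuous_on_kernel_series:
  assumes "lam > 0" "kernel_summable lam s"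
  shows "continuous_on {-1..1} (kernel_series lam s)"
proof (rule uniform_limit_theorem[OF _ uniform_limit_kernel_series[OF assms]])
  show "\<forall>\<^sub>F N in sequentially. continuous_on {-1..1} (\<lambda>t. \<Sum>l<N. s l * gegenbauer_kernel lam l t)"
    unfolding gegenbauer_kernel_def
    by (intro always_eventually allI continuous_intros continuous_on_gegenbauer[OF assms(1)])
qed simp

lemma LINT_weight_le:
  assumes "lam \<ge> 1/2"
  shows "(LINT t:{-1..1}|lborel. gegenbauer_weight lam t) \<le> 2"
proof -
  have "set_integrable lborel {-1..1} (\<lambda>t. 1 * gegenbauer_weight lam t)"
    by (intro set_integrable_times_weight assms continuous_intros)
  moreover have "set_integrable lborel {-1..1::real} (\<lambda>_. 1::real)"
    unfolding set_integrable_def by (intro borel_integrable_compact) auto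
  ultimately have "(LINT t:{-1..1}|lborel. gegenbauer_weight lam t) \<le> (LINT t:{-1..1::real}|lborel. 1)"
    using gegenbauer_weight_bounds[OF assms] by (intro set_integral_mono) auto
  thus ?thesis by (simp add: set_lebesgue_integral_def)
qed

text \<open>
  The partial sums converge uniformly, hence in the weighted \<open>L\<^sup>2\<close> norm, since the total weight
  is finite.
\<close>

lemma gegenbauer_expansion_kernel_series:
  assumes "lam \<ge> 1/2" "kernel_summable lam s"
  shows "gegenbauer_expansion lam (kernel_series lam s) (\<lambda>l. s l * ((lam + real l) / lam))"
proof -
  have pos: "lam > 0" using assms(1) by simp
  let ?f = "kernel_series lam s" and ?w = "gegenbauer_weight lam"
  let ?S = "\<lambda>N t. \<Sum>l<N. s l * ((lam + real l) / lam) * gegenbauer lam l t"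
  note contf = continuous_on_kernel_series[OF pos assms(2)]
  have int: "set_integrable lborel {-1..1} (\<lambda>t. (?f t - ?S N t)\<^sup>2 * ?w t)" for N
    by (intro set_integrable_times_weight assms continuous_intros contf continuous_on_gegenbauer[OF pos])
  have "set_borel_measurable lborel {-1..1} ?f"
  proof -
    have "(\<lambda>t. indicator {-1..1} t *\<^sub>R ?f t) \<in> borel_measurable borel"
      using contf by (intro borel_measurable_continuous_on_indicator) auto
    thus ?thesis by (simp add: set_borel_measurable_def)
  qed
  moreover have "(\<lambda>N. LINT t:{-1..1}|lborel. (?f t - ?S N t)\<^sup>2 * ?w t) \<longlonglongrightarrow> 0"
  proof (rule tendstoI)
    fix \<epsilon> :: real assume "\<epsilon> > 0"
    \<comment> \<open>The square of a uniform error \<open>d \<le> 1\<close> is at most \<open>d\<close>, and the total weight is at most 2.\<close>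
    define d where "d = min 1 (\<epsilon> / 4)"
    have d: "d > 0" "d \<le> 1" "2 * d < \<epsilon>" using \<open>\<epsilon> > 0\<close> by (auto simp: d_def min_def)
    have "\<forall>\<^sub>F N in sequentially. \<forall>t\<in>{-1..1}. dist (\<Sum>l<N. s l * gegenbauer_kernel lam l t) (?f t) < d"
      using uniform_limitD[OF uniform_limit_kernel_series[OF pos assms(2)] d(1)] .
    thus "\<forall>\<^sub>F N in sequentially. dist (LINT t:{-1..1}|lborel. (?f t - ?S N t)\<^sup>2 * ?w t) 0 < \<epsilon>"
    proof eventually_elim
      case (elim N)
      have "(LINT t:{-1..1}|lborel. (?f t - ?S N t)\<^sup>2 * ?w t) \<le> (LINT t:{-1..1}|lborel. d * ?w t)"
      proof (rule set_integral_mono[OF int])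
        show "set_integrable lborel {-1..1} (\<lambda>t. d * ?w t)"
          by (intro set_integrable_times_weight assms continuous_intros)
        fix t :: real assume t: "t \<in> {-1..1}"
        have "\<bar>?f t - ?S N t\<bar> \<le> d"
          using elim t by (force simp: dist_real_def abs_minus_commute gegenbauer_kernel_def mult.assoc)
        hence "(?f t - ?S N t)\<^sup>2 \<le> d\<^sup>2" by (simp add: abs_le_square_iff[symmetric])
        also have "\<dots> \<le> d" using d by (simp add: power2_eq_square mult_left_le)
        finally show "(?f t - ?S N t)\<^sup>2 * ?w t \<le> d * ?w t"
          using gegenbauer_weight_bounds(1)[OF assms(1) t] by (rule mult_right_mono)
      qed
      also have "\<dots> = d * (LINT t:{-1..1}|lborel. ?w t)" by simp
      also have "\<dots> \<le> d * 2" using LINT_weight_le[OF assms(1)] d by (intro mult_left_mono) auto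
      also have "\<dots> < \<epsilon>" using d by simp
      finally have "(LINT t:{-1..1}|lborel. (?f t - ?S N t)\<^sup>2 * ?w t) < \<epsilon>" .
      moreover have "(LINT t:{-1..1}|lborel. (?f t - ?S N t)\<^sup>2 * ?w t) \<ge> 0"
        unfolding set_lebesgue_integral_def using gegenbauer_weight_bounds[OF assms(1)]
        by (intro Bochner_Integration.integral_nonneg) (auto simp: indicator_def)
      ultimately show ?case by simp
    qed
  qed
  ultimately show ?thesis using int unfolding gegenbauer_expansion_def by blast
qed

text \<open>
  Integrated term by term: the kernel of degree 0 is 1, and the others are orthogonal to it.
\<close>

lemma LINT_kernel_series_weight:
  assumes "lam \<ge> 1/2" "kernel_summable lam s"
  shows "(LINT t:{-1..1}|lborel. kernel_series lam s t * gegenbauer_weight lam t)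
           = s 0 * (LINT t:{-1..1}|lborel. gegenbauer_weight lam t)"
proof -
  have pos: "lam > 0" using assms(1) by simp
  let ?w = "gegenbauer_weight lam"
  let ?W = "LINT t:{-1..1}|lborel. ?w t"
  define g where "g l t = indicator {-1..1} t *\<^sub>R (s l * gegenbauer_kernel lam l t * ?w t)" for l t
  have int: "integrable lborel (g l)" for l
    unfolding g_def[abs_def] set_integrable_def[symmetric] gegenbauer_kernel_def
    by (intro set_integrable_times_weight assms continuous_intros continuous_on_gegenbauer[OF pos])
  have intw: "integrable lborel (\<lambda>t. c * (indicator {-1..1} t * ?w t))" for c :: real
  proof -
    have "set_integrable lborel {-1..1} (\<lambda>t. c * ?w t)"
      by (intro set_integrable_times_weight assms continuous_intros)
    thus ?thesis by (simp add: set_integrable_def mult_ac)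
  qed
  have bound: "norm (g l t) \<le> \<bar>s l\<bar> * gegenbauer_kernel lam l 1 * (indicator {-1..1} t * ?w t)" for l t
    using kernel_term_le[OF pos, of t s l] gegenbauer_weight_bounds[OF assms(1), of t]
    by (auto simp: g_def indicator_def abs_mult[of "_ * _" "?w t"] intro: mult_right_mono)
  have "summable (\<lambda>l. \<integral>t. norm (g l t) \<partial>lborel)"
  proof (rule summable_comparison_test'[of "\<lambda>l. \<bar>s l\<bar> * gegenbauer_kernel lam l 1 * ?W" 0])
    show "summable (\<lambda>l. \<bar>s l\<bar> * gegenbauer_kernel lam l 1 * ?W)"
      using assms(2) unfolding kernel_summable_def by (rule summable_mult2)
    fix l
    have "(\<integral>t. norm (g l t) \<partial>lborel)
       \<le> (\<integral>t. \<bar>s l\<bar> * gegenbauer_kernel lam l 1 * (indicator {-1..1} t * ?w t) \<partial>lborel)"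
      using bound int by (intro integral_mono intw) auto
    thus "norm (\<integral>t. norm (g l t) \<partial>lborel) \<le> \<bar>s l\<bar> * gegenbauer_kernel lam l 1 * ?W"
      by (simp add: set_lebesgue_integral_def)
  qed
  moreover have summ: "summable (\<lambda>l. norm (g l t))" for t
  proof (cases "t \<in> {-1..1}")
    case True
    hence "norm (g l t) = \<bar>s l * gegenbauer_kernel lam l t\<bar> * ?w t" for l
      using gegenbauer_weight_bounds[OF assms(1), of t] by (simp add: g_def abs_mult)
    thus ?thesis using kernel_series_summable[OF pos assms(2) True] by (simp add: summable_mult2)
  qed (simp add: g_def)
  ultimately have "(\<lambda>l. integral\<^sup>L lborel (g l)) sums (\<integral>t. (\<Sum>l. g l t) \<partial>lborel)"
    using int by (intro sums_integral) auto
  moreover have "(\<Sum>l. g l t) = indicator {-1..1} t *\<^sub>R (kernel_series lam s t * ?w t)" for t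
  proof (cases "t \<in> {-1..1}")
    case True
    thus ?thesis
      using sums_mult2[OF kernel_series_sums[OF pos assms(2) True], of "?w t"]
      by (simp add: g_def sums_iff)
  qed (simp add: g_def)
  ultimately have "(\<lambda>l. integral\<^sup>L lborel (g l)) sums
      (LINT t:{-1..1}|lborel. kernel_series lam s t * ?w t)"
    by (simp add: set_lebesgue_integral_def)
  moreover have "integral\<^sup>L lborel (g l) = (if l = 0 then s 0 * ?W else 0)" for l
  proof -
    have "integral\<^sup>L lborel (g l)
        = (LINT t:{-1..1}|lborel. s l * ((lam + real l) / lam) * (gegenbauer lam l t * gegenbauer lam 0 t * ?w t))"
      unfolding g_def[abs_def] set_lebesgue_integral_def[symmetric]
      using gegenbauer_recurrence(1)[OF pos]
      by (intro set_lebesgue_integral_cong) (auto simp: gegenbauer_kernel_def)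
    also have "\<dots> = s l * ((lam + real l) / lam) *
          (LINT t:{-1..1}|lborel. gegenbauer lam l t * gegenbauer lam 0 t * ?w t)"
      by (rule set_integral_mult_right)
    also have "(LINT t:{-1..1}|lborel. gegenbauer lam l t * gegenbauer lam 0 t * ?w t) = (if l = 0 then ?W else 0)"
    proof (cases "l = 0")
      case True
      show ?thesis using True gegenbauer_recurrence(1)[OF pos]
        by (auto intro!: set_lebesgue_integral_cong)
    qed (use gegenbauer_orthogonal[OF assms(1)] in auto)
    finally show ?thesis using pos by auto
  qed
  ultimately have "(\<lambda>l. if l = 0 then s 0 * ?W else 0) sums
      (LINT t:{-1..1}|lborel. kernel_series lam s t * ?w t)" by simp
  thus ?thesis using sums_unique2[OF _ sums_single[of 0 "\<lambda>_. s 0 * ?W"]] by simp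
qed

section \<open>Integrating the Poisson wavelets over scales\<close>

text \<open>
  The regularised upper incomplete Gamma function at the integer \<open>m\<close>. It is, up to sign, the
  antiderivative of \<open>poisson_profile m x / x\<close>, and it equals 1 at 0, if \<open>m \<ge> 1\<close>; so it
  gives the integral over the scales \<open>a > R\<close> in closed form and contains the admissibility condition as
  the case \<open>R = 0\<close>.
\<close>

definition poisson_tail :: "nat \<Rightarrow> real \<Rightarrow> real" where
  "poisson_tail m x = exp (- x) * (\<Sum>j<m. x ^ j / fact j)"

lemma poisson_tail_0: "m \<ge> 1 \<Longrightarrow> poisson_tail m 0 = 1"
  by (cases m) (simp_all add: poisson_tail_def sum.lessThan_Suc_shift del: sum.lessThan_Suc)

lemma poisson_tail_nonneg: "x \<ge> 0 \<Longrightarrow> poisson_tail m x \<ge> 0"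
  by (auto simp: poisson_tail_def intro!: mult_nonneg_nonneg sum_nonneg)

text \<open>
  A power of \<open>x / 2\<close> over a factorial is absorbed by half of the exponential.
\<close>

lemma poisson_tail_le:
  assumes "x \<ge> 0"
  shows "poisson_tail m x \<le> 2 ^ m * exp (- x / 2)"
proof -
  have "(\<Sum>j<m. x ^ j / fact j) \<le> (\<Sum>j<m. 2 ^ m * ((x/2) ^ j / fact j))"
  proof (rule sum_mono)
    fix j assume "j \<in> {..<m}"
    hence "(2::real) ^ j \<le> 2 ^ m" by (intro power_increasing) auto
    hence "2 ^ j * ((x/2) ^ j / fact j) \<le> 2 ^ m * ((x/2) ^ j / fact j)"
      using assms by (intro mult_right_mono) auto
    thus "x ^ j / fact j \<le> 2 ^ m * ((x/2) ^ j / fact j)" by (simp add: power_divide)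
  qed
  also have "\<dots> \<le> 2 ^ m * exp (x/2)"
  proof -
    have "(\<Sum>j<m. (x/2) ^ j / fact j) \<le> exp (x/2)"
      using assms summable_exp_generic[of "x/2"] unfolding exp_def
      by (auto simp: field_simps scaleR_conv_of_real intro!: sum_le_suminf)
    thus ?thesis unfolding sum_distrib_left[symmetric] by simp
  qed
  finally have "poisson_tail m x \<le> exp (- x) * (2 ^ m * exp (x/2))"
    unfolding poisson_tail_def by (intro mult_left_mono) auto
  also have "\<dots> = 2 ^ m * exp (- x + x/2)" unfolding exp_add by simp
  finally show ?thesis by simp
qed

lemma poisson_profile_Suc: "poisson_profile (Suc k) x = x ^ Suc k / fact k * exp (- x)"
  using Gamma_fact[of k, where 'a = real] by (simp add: poisson_profile_def)

lemma poisson_profile_nonneg: "m \<ge> 1 \<Longrightarrow> x \<ge> 0 \<Longrightarrow> poisson_profile m x \<ge> 0"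
  by (cases m) (auto simp: poisson_profile_Suc)

lemma poisson_profile_0: "m \<ge> 1 \<Longrightarrow> poisson_profile m 0 = 0"
  by (simp add: poisson_profile_def)

lemma poisson_profile_le:
  assumes "m \<ge> 1" "x \<ge> 0"
  shows "poisson_profile m x \<le> real m * 2 ^ Suc m * exp (- x / 2)"
proof -
  obtain k where k: "m = Suc k" using assms(1) by (cases m) auto
  have "poisson_profile m x = real m * (exp (- x) * (x ^ m / fact m))"
    unfolding k poisson_profile_Suc fact_Suc by (simp del: of_nat_Suc)
  also have "\<dots> \<le> real m * poisson_tail (Suc m) x"
    unfolding poisson_tail_def using assms(2)
    by (intro mult_left_mono member_le_sum) auto
  also have "\<dots> \<le> real m * (2 ^ Suc m * exp (- x / 2))"
    by (intro mult_left_mono poisson_tail_le assms) auto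
  finally show ?thesis by (simp only: mult.assoc)
qed

lemma poisson_tail_DERIV:
  "(poisson_tail (Suc k) has_real_derivative - (x ^ k / fact k * exp (- x))) (at x)"
proof (induction k)
  case 0
  show ?case unfolding poisson_tail_def[abs_def] by (auto intro!: derivative_eq_intros)
next
  case (Suc k)
  have eq: "poisson_tail (Suc (Suc k)) = (\<lambda>x. poisson_tail (Suc k) x + exp (- x) * (x ^ Suc k / fact (Suc k)))"
    by (rule ext) (simp add: poisson_tail_def algebra_simps)
  have "((\<lambda>x. x ^ Suc k / fact (Suc k)) has_real_derivative x ^ k / fact k) (at x)"
  proof -
    have "((\<lambda>x. x ^ Suc k / fact (Suc k)) has_real_derivative real (Suc k) * x ^ k / fact (Suc k)) (at x)"
      using DERIV_cdivide[OF DERIV_pow[of "Suc k" x], of "fact (Suc k)"]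
      by (simp del: of_nat_Suc fact_Suc)
    thus ?thesis unfolding fact_Suc of_nat_mult by (simp del: of_nat_Suc)
  qed
  moreover have "((\<lambda>x. exp (- x)) has_real_derivative - exp (- x)) (at x)"
    by (auto intro!: derivative_eq_intros)
  ultimately have "((\<lambda>x. exp (- x) * (x ^ Suc k / fact (Suc k))) has_real_derivative
     (- exp (- x) * (x ^ Suc k / fact (Suc k)) + x ^ k / fact k * exp (- x))) (at x)"
    by (rule DERIV_mult[rotated])
  from DERIV_add[OF Suc.IH this] show ?case unfolding eq by (simp add: mult_ac)
qed

lemma poisson_profile_integral:
  assumes "m \<ge> 1" "l \<ge> 1" "R \<ge> 0"
  shows "has_bochner_integral lborel (\<lambda>a. indicator {R<..} a *\<^sub>R (poisson_profile m (a * real l) / a))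
           (poisson_tail m (R * real l))"
proof -
  obtain k where k: "m = Suc k" using assms(1) by (cases m) auto
  \<comment> \<open>This form of \<open>poisson_profile m (a l) / a\<close> is also a derivative at \<open>a = 0\<close>, where the
      quotient itself takes the value \<open>0\<close> by the convention for division by 0.\<close>
  define f where "f a = real l * ((a * real l) ^ k / fact k * exp (- (a * real l)))" for a :: real
  have l: "real l > 0" using assms(2) by simp
  have "(\<integral>\<^sup>+a. ennreal (f a) * indicator {R..} a \<partial>lborel) = ennreal (0 - (- poisson_tail m (R * real l)))"
  proof (rule nn_integral_FTC_atLeast)
    show "f \<in> borel_measurable borel" unfolding f_def[abs_def] by measurable
    show "((\<lambda>a. - poisson_tail m (a * real l)) has_real_derivative f a) (at a)" for a
    proof -
      have "((\<lambda>a. a * real l) has_real_derivative real l) (at a)"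
        by (auto intro!: derivative_eq_intros)
      from DERIV_minus[OF DERIV_chain2[OF poisson_tail_DERIV[of k "a * real l"] this]]
      show ?thesis unfolding k f_def by (simp add: mult_ac)
    qed
    show "0 \<le> f a" if "R \<le> a" for a using that assms(3) by (simp add: f_def)
    have "((\<lambda>a. poisson_tail m (a * real l)) \<longlongrightarrow> 0) at_top"
    proof (rule tendsto_sandwich)
      show "\<forall>\<^sub>F a in at_top. 0 \<le> poisson_tail m (a * real l)"
        using eventually_ge_at_top[of 0] by eventually_elim (simp add: poisson_tail_nonneg)
      show "\<forall>\<^sub>F a in at_top. poisson_tail m (a * real l) \<le> 2 ^ m * exp (- (a * real l) / 2)"
        using eventually_ge_at_top[of 0] by eventually_elim (rule poisson_tail_le, simp)
      have "filterlim (\<lambda>a. a * (real l / 2)) at_top at_top"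
        using l by (intro filterlim_at_top_mult_tendsto_pos[OF tendsto_const] filterlim_ident) auto
      from tendsto_mult_right_zero[OF filterlim_compose[OF exp_at_bot
           filterlim_compose[OF filterlim_uminus_at_bot_at_top this]], of "2 ^ m"]
      show "((\<lambda>a. 2 ^ m * exp (- (a * real l) / 2)) \<longlongrightarrow> 0) at_top"
        by (simp only: times_divide_eq_right minus_divide_left)
    qed simp
    from tendsto_minus[OF this]
    show "((\<lambda>a. - poisson_tail m (a * real l)) \<longlongrightarrow> 0) at_top" by simp
  qed
  moreover have "(\<integral>\<^sup>+a. ennreal (indicator {R..} a *\<^sub>R f a) \<partial>lborel)
      = (\<integral>\<^sup>+a. ennreal (f a) * indicator {R..} a \<partial>lborel)"
    by (intro nn_integral_cong) (auto simp: indicator_def)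
  moreover have "0 \<le> indicator {R..} a *\<^sub>R f a" for a
    using assms(3) by (auto simp: indicator_def f_def)
  moreover have "(\<lambda>a. indicator {R..} a *\<^sub>R f a) \<in> borel_measurable lborel"
    unfolding f_def by measurable
  ultimately have "has_bochner_integral lborel (\<lambda>a. indicator {R..} a *\<^sub>R f a) (poisson_tail m (R * real l))"
    using assms(3) by (intro has_bochner_integral_nn_integral) (auto simp: poisson_tail_nonneg)
  moreover have "AE a in lborel. a \<noteq> R" by (rule AE_lborel_singleton)
  hence "AE a in lborel. indicator {R..} a *\<^sub>R f a
      = indicator {R<..} a *\<^sub>R (poisson_profile m (a * real l) / a)"
  proof eventually_elim
    case (elim a)
    show ?case
    proof (cases "a > R")
      case True
      hence "a > 0" using assms(3) by simp
      thus ?thesis using True unfolding k poisson_profile_Suc f_def by simp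
    next
      case False
      hence "a < R" using elim by simp
      thus ?thesis by simp
    qed
  qed
  moreover have "(\<lambda>a. indicator {R..} a *\<^sub>R f a) \<in> borel_measurable lborel"
    "(\<lambda>a. indicator {R<..} a *\<^sub>R (poisson_profile m (a * real l) / a)) \<in> borel_measurable lborel"
    unfolding f_def poisson_profile_def by measurable
  ultimately show ?thesis
    using has_bochner_integral_cong_AE by blast
qed

lemma kernel_summable_poisson_profile:
  assumes "lam > 0" "m \<ge> 1" "a > 0"
  shows "kernel_summable lam (\<lambda>l. poisson_profile m (a * real l))"
proof (rule kernel_summable_exp_bound[OF assms(1)])
  show "\<bar>poisson_profile m (a * real l)\<bar> \<le> real m * 2 ^ Suc m * exp (- (a / 2 * real l))" for l
    using poisson_profile_le[OF assms(2), of "a * real l"] poisson_profile_nonneg[OF assms(2), of "a * real l"]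
      assms(3) by simp
qed (use assms in auto)

lemma kernel_summable_poisson_tail:
  assumes "lam > 0" "R > 0"
  shows "kernel_summable lam (\<lambda>l. poisson_tail m (R * real l))"
proof (rule kernel_summable_exp_bound[OF assms(1)])
  show "\<bar>poisson_tail m (R * real l)\<bar> \<le> 2 ^ m * exp (- (R / 2 * real l))" for l
    using poisson_tail_le[of "R * real l" m] poisson_tail_nonneg[of "R * real l" m] assms(2) by simp
qed (use assms in auto)

lemma kernel_summable_exp:
  assumes "lam > 0" "R > 0"
  shows "kernel_summable lam (\<lambda>l. exp (- (R * real l)))"
  by (rule kernel_summable_exp_bound[OF assms, of _ 1]) simp

lemma poisson_wavelet_eq_kernel_series:
  "poisson_wavelet lam m a = kernel_series lam (\<lambda>l. poisson_profile m (a * real l))"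
  by (rule ext) (simp add: poisson_wavelet_def kernel_series_def)

text \<open>
  Series and integral may be exchanged because the sum of the integrals of the absolute values
  is dominated by the summable series with coefficients \<open>poisson_tail m (R l)\<close>. The term of
  degree 0 is exceptional: its profile vanishes, whereas \<open>poisson_tail m 0 = 1\<close>. This
  accounts for the subtraction of 1.
\<close>

lemma scale_integral_poisson_wavelet:
  assumes "lam > 0" "m \<ge> 1" "R > 0" "t \<in> {-1..1}"
  shows "set_integrable lborel {R<..} (\<lambda>a. poisson_wavelet lam m a t / a)"
    and "(LINT a:{R<..}|lborel. poisson_wavelet lam m a t / a)
           = kernel_series lam (\<lambda>l. poisson_tail m (R * real l)) t - 1"
proof -
  let ?K = "\<lambda>l. gegenbauer_kernel lam l t"
  define g where "g l a = ?K l * (indicator {R<..} a *\<^sub>R (poisson_profile m (a * real l) / a))" for l a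
  define I where "I l = ?K l * (poisson_tail m (R * real l) - (if l = 0 then 1 else 0))" for l
  note tail0 = poisson_tail_0[OF assms(2)]
  have base: "has_bochner_integral lborel (\<lambda>a. indicator {R<..} a *\<^sub>R (poisson_profile m (a * real l) / a))
      (poisson_tail m (R * real l) - (if l = 0 then 1 else 0))" for l
  proof (cases "l = 0")
    case True
    thus ?thesis using assms(2) by (simp add: poisson_profile_0 tail0 has_bochner_integral_zero)
  next
    case False
    thus ?thesis using poisson_profile_integral[OF assms(2), of l R] assms(3) by simp
  qed
  have g: "has_bochner_integral lborel (g l) (I l)" for l
    unfolding g_def[abs_def] I_def by (rule has_bochner_integral_mult_right[OF base])
  have normg: "norm (g l a) = \<bar>?K l\<bar> * (indicator {R<..} a *\<^sub>R (poisson_profile m (a * real l) / a))" for l a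
    using poisson_profile_nonneg[OF assms(2), of "a * real l"] assms(3)
    by (auto simp: g_def indicator_def abs_mult)
  have "summable (\<lambda>l. norm (\<integral>a. norm (g l a) \<partial>lborel))"
  proof (rule summable_comparison_test'[of "\<lambda>l. \<bar>poisson_tail m (R * real l)\<bar> * gegenbauer_kernel lam l 1" 0])
    show "summable (\<lambda>l. \<bar>poisson_tail m (R * real l)\<bar> * gegenbauer_kernel lam l 1)"
      using kernel_summable_poisson_tail[OF assms(1,3)] by (simp add: kernel_summable_def)
    fix l
    have "(\<integral>a. norm (g l a) \<partial>lborel) = \<bar>?K l\<bar> * (poisson_tail m (R * real l) - (if l = 0 then 1 else 0))"
      unfolding normg by (rule has_bochner_integral_integral_eq[OF has_bochner_integral_mult_right[OF base]])
    also have "norm \<dots> \<le> \<bar>poisson_tail m (R * real l)\<bar> * gegenbauer_kernel lam l 1"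
      using abs_gegenbauer_kernel_le[OF assms(1,4), of l] gegenbauer_kernel_1_nonneg[OF assms(1), of 0]
      by (auto simp: abs_mult tail0 mult.commute[of "\<bar>?K l\<bar>"] intro: mult_left_mono)
    finally show "norm (norm (\<integral>a. norm (g l a) \<partial>lborel)) \<le> \<bar>poisson_tail m (R * real l)\<bar> * gegenbauer_kernel lam l 1"
      by simp
  qed
  hence sum_int: "summable (\<lambda>l. \<integral>a. norm (g l a) \<partial>lborel)"
    by (rule summable_norm_cancel)
  have summ: "AE a in lborel. summable (\<lambda>l. norm (g l a))"
  proof (rule AE_I2)
    fix a
    show "summable (\<lambda>l. norm (g l a))"
    proof (cases "a > R")
      case True
      hence a: "a > 0" using assms(3) by simp
      have "norm (g l a) = \<bar>poisson_profile m (a * real l) * ?K l\<bar> * (1 / a)" for l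
        using True a by (simp add: g_def abs_mult mult_ac)
      thus ?thesis
        using kernel_series_summable[OF assms(1) kernel_summable_poisson_profile[OF assms(1,2) a] assms(4)]
        by (simp only: summable_mult2)
    qed (simp add: g_def)
  qed
  have eq: "(\<Sum>l. g l a) = indicator {R<..} a *\<^sub>R (poisson_wavelet lam m a t / a)" for a
  proof (cases "a > R")
    case True
    hence a: "a > 0" using assms(3) by simp
    from sums_divide[OF kernel_series_sums[OF assms(1) kernel_summable_poisson_profile[OF assms(1,2) a] assms(4)], of a]
    have "(\<lambda>l. g l a) sums (poisson_wavelet lam m a t / a)"
      using True by (simp add: g_def poisson_wavelet_eq_kernel_series mult_ac)
    thus ?thesis using True by (simp add: sums_iff)
  qed (simp add: g_def)
  have intg: "integrable lborel (g l)" for l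
    using g[of l] by (simp add: has_bochner_integral_iff)
  show "set_integrable lborel {R<..} (\<lambda>a. poisson_wavelet lam m a t / a)"
    using integrable_suminf[OF intg summ sum_int] unfolding eq set_integrable_def .
  have "I sums (LINT a:{R<..}|lborel. poisson_wavelet lam m a t / a)"
    using sums_integral[OF intg summ sum_int] has_bochner_integral_integral_eq[OF g]
    unfolding eq set_lebesgue_integral_def by simp
  moreover have "I sums (kernel_series lam (\<lambda>l. poisson_tail m (R * real l)) t - 1)"
  proof -
    have "I = (\<lambda>l. poisson_tail m (R * real l) * ?K l - (if l = 0 then 1 else 0))"
      using gegenbauer_kernel_0[OF assms(1,4)] by (auto simp: I_def algebra_simps)
    thus ?thesis
      using sums_diff[OF kernel_series_sums[OF assms(1) kernel_summable_poisson_tail[OF assms(1,3)] assms(4)]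
          sums_single[of 0 "\<lambda>_. 1::real"]] by simp
  qed
  ultimately show "(LINT a:{R<..}|lborel. poisson_wavelet lam m a t / a)
           = kernel_series lam (\<lambda>l. poisson_tail m (R * real l)) t - 1"
    by (rule sums_unique2)
qed

section \<open>Domination by the Poisson kernel\<close>

lemma higher_deriv_exp_sum:
  fixes c :: "nat \<Rightarrow> complex"
  shows "(deriv ^^ j) (\<lambda>\<zeta>. \<Sum>l<N. c l * exp (- (of_nat l * \<zeta>)))
           = (\<lambda>\<zeta>. \<Sum>l<N. c l * (- of_nat l) ^ j * exp (- (of_nat l * \<zeta>)))"
proof (induction j arbitrary: c)
  case (Suc j)
  have "deriv (\<lambda>\<zeta>. \<Sum>l<N. c l * exp (- (of_nat l * \<zeta>)))
      = (\<lambda>\<zeta>. \<Sum>l<N. (c l * (- of_nat l)) * exp (- (of_nat l * \<zeta>)))"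
  proof (rule ext, rule DERIV_imp_deriv, rule DERIV_sum)
    fix \<zeta> l
    show "((\<lambda>\<zeta>. c l * exp (- (of_nat l * \<zeta>))) has_field_derivative
       (c l * (- of_nat l)) * exp (- (of_nat l * \<zeta>))) (at \<zeta>)"
      by (auto intro!: derivative_eq_intros)
  qed
  thus ?case unfolding funpow_Suc_right o_def using Suc.IH[of "\<lambda>l. c l * (- of_nat l)"]
    by (simp add: mult_ac)
qed simp

lemma norm_exp_minus_diff_le:
  fixes x y :: complex
  assumes "Re x \<ge> b" "Re y \<ge> b"
  shows "norm (exp (- x) - exp (- y)) \<le> exp (- b) * norm (x - y)"
proof (rule field_differentiable_bound[where S = "{z. Re z \<ge> b}" and f' = "\<lambda>z. - exp (- z)"])
  show "convex {z. Re z \<ge> b}" by (rule convex_halfspace_Re_ge)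
  show "((\<lambda>z. exp (- z)) has_field_derivative - exp (- z)) (at z within {z. Re z \<ge> b})" for z :: complex
    by (auto intro!: derivative_eq_intros)
qed (use assms in auto)

lemma times_exp_minus_le:
  fixes s :: real
  shows "s * exp (- s) \<le> 1 - exp (- s)"
proof -
  have "(1 + s) * exp (- s) \<le> exp s * exp (- s)"
    using exp_ge_add_one_self[of s] by (intro mult_right_mono) auto
  thus ?thesis by (simp add: algebra_simps flip: exp_add)
qed

lemma Re_ge_half:
  assumes "norm (\<zeta> - of_real R) \<le> R / 2"
  shows "Re \<zeta> \<ge> R / 2"
  using abs_Re_le_cmod[of "\<zeta> - of_real R"] assms by auto

text \<open>
  On the disc of radius \<open>R / 2\<close> around \<open>R\<close>, passing from \<open>R\<close> to \<open>\<zeta>\<close> changes the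
  exponential by at most \<open>s exp (- s) \<le> 1 - exp (- s)\<close> with \<open>s = R / 2\<close>, which is a lower
  bound for the modulus at \<open>\<zeta>\<close>. The constant depends neither on \<open>R\<close> nor on \<open>u\<close>.
\<close>

lemma norm_one_minus_exp_comparison:
  fixes u \<zeta> :: complex
  assumes "norm u = 1" "R > 0" "norm (\<zeta> - of_real R) \<le> R / 2"
  shows "norm (1 - u * exp (- of_real R)) \<le> 2 * norm (1 - u * exp (- \<zeta>))"
proof -
  let ?v = "1 - u * exp (- of_real R)" and ?w = "1 - u * exp (- \<zeta>)"
  have "norm (?v - ?w) = norm (u * (exp (- \<zeta>) - exp (- of_real R)))"
    by (simp add: algebra_simps)
  also have "\<dots> = norm (exp (- \<zeta>) - exp (- of_real R))" using assms(1) by (simp only: norm_mult)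
  also have "\<dots> \<le> exp (- (R / 2)) * norm (\<zeta> - of_real R)"
    using Re_ge_half[OF assms(3)] assms(2) by (intro norm_exp_minus_diff_le) auto
  also have "\<dots> \<le> exp (- (R / 2)) * (R / 2)" using assms(3) by (intro mult_left_mono) auto
  also have "\<dots> \<le> 1 - exp (- (R / 2))" using times_exp_minus_le[of "R / 2"] by (simp add: mult.commute)
  also have "\<dots> \<le> 1 - norm (u * exp (- \<zeta>))"
    using Re_ge_half[OF assms(3)] assms(1) by (simp add: norm_mult)
  also have "\<dots> \<le> norm ?w" using norm_triangle_ineq2[of 1 "u * exp (- \<zeta>)"] by simp
  finally show ?thesis using norm_triangle_ineq2[of ?v ?w] by linarith
qed

lemma norm_one_minus_exp_square_comparison:
  fixes \<zeta> :: complex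
  assumes "R > 0" "norm (\<zeta> - of_real R) \<le> R / 2"
  shows "norm (1 - (exp (- \<zeta>))\<^sup>2) \<le> 2 * (1 - (exp (- R))\<^sup>2)"
proof -
  have sq: "(exp (- z))\<^sup>2 = exp (- (2 * z))" for z :: "'b::{real_normed_field,banach}"
    by (simp add: power2_eq_square flip: exp_add)
  have "norm (exp (- (2 * of_real R)) - exp (- (2 * \<zeta>))) \<le> exp (- R) * norm (2 * of_real R - 2 * \<zeta>)"
    using Re_ge_half[OF assms(2)] assms(1) by (intro norm_exp_minus_diff_le) auto
  also have "norm (2 * of_real R - 2 * \<zeta>) = 2 * norm (\<zeta> - of_real R)"
  proof -
    have "2 * of_real R - 2 * \<zeta> = 2 * (of_real R - \<zeta>)" by simp
    thus ?thesis by (simp only: norm_mult norm_minus_commute) simp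
  qed
  also have "exp (- R) * \<dots> \<le> exp (- R) * R" using assms(2) by (intro mult_left_mono) auto
  also have "\<dots> \<le> 1 - exp (- R)" using times_exp_minus_le[of R] by (simp add: mult.commute)
  also have "\<dots> \<le> 1 - exp (- (2 * R))" using assms(1) by simp
  finally have diff: "norm (exp (- (2 * of_real R)) - exp (- (2 * \<zeta>))) \<le> 1 - exp (- (2 * R))" .
  have real: "norm (1 - exp (- (2 * of_real R :: complex))) = 1 - exp (- (2 * R))"
  proof -
    have "1 - exp (- (2 * of_real R :: complex)) = of_real (1 - exp (- (2 * R)))"
      by (simp add: exp_of_real[symmetric])
    thus ?thesis using assms(1) by (simp only: norm_of_real) simp
  qed
  have "norm (1 - exp (- (2 * \<zeta>)))
      \<le> norm (1 - exp (- (2 * of_real R :: complex))) + norm (exp (- (2 * of_real R)) - exp (- (2 * \<zeta>)))"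
    using norm_triangle_ineq[of "1 - exp (- (2 * of_real R :: complex))" "exp (- (2 * of_real R)) - exp (- (2 * \<zeta>))"]
    by simp
  also have "\<dots> \<le> (1 - exp (- (2 * R))) + (1 - exp (- (2 * R)))"
    by (intro add_mono diff real[THEN eq_refl])
  finally show ?thesis unfolding sq by simp
qed

lemma norm_one_minus_mult_pos:
  fixes u z :: complex
  assumes "norm u = 1" "norm z < 1"
  shows "norm (1 - u * z) > 0"
proof -
  have "norm (u * z) < 1" using assms by (simp add: norm_mult)
  thus ?thesis using norm_triangle_ineq2[of 1 "u * z"] by (simp only: norm_one)
qed

lemma norm_poisson_kernel:
  assumes "norm u = 1" "norm z < 1"
  shows "norm (poisson_kernel lam u z)
           = norm (1 - z\<^sup>2) * (norm (1 - u * z) * norm (1 - cnj u * z)) powr (- (lam + 1))"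
proof -
  let ?A = "norm (1 - u * z)" and ?B = "norm (1 - cnj u * z)"
  have "?A > 0" "?B > 0" using assms by (auto intro!: norm_one_minus_mult_pos simp del: zero_less_norm_iff)
  moreover have "norm (gegenbauer_gf lam u z) = ?A powr (- lam) * ?B powr (- lam)"
    by (simp add: gegenbauer_gf_def norm_mult norm_powr_real_powr')
  moreover have "- (lam + 1) = - lam - 1" by simp
  ultimately show ?thesis
    by (simp only: poisson_kernel_def norm_mult norm_divide powr_mult powr_diff)
       (simp add: field_simps)
qed

text \<open>
  A Harnack-type inequality with a constant independent of \<open>R\<close> and \<open>u\<close>. The numerator grows
  at most by the factor 2, and each of the two denominators shrinks at most by the factor
  \<open>2 powr (lam + 1)\<close>.
\<close>

lemma norm_poisson_kernel_comparison:
  assumes "lam > 0" "norm u = 1" "R > 0" "norm (\<zeta> - of_real R) \<le> R / 2"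
  shows "norm (poisson_kernel lam u (exp (- \<zeta>)))
           \<le> 2 * 4 powr (lam + 1) * norm (poisson_kernel lam u (exp (- of_real R)))"
proof -
  let ?A = "\<lambda>\<zeta>. norm (1 - u * exp (- \<zeta>))" and ?B = "\<lambda>\<zeta>. norm (1 - cnj u * exp (- \<zeta>))"
  let ?R = "complex_of_real R"
  have "Re \<zeta> > 0" using Re_ge_half[OF assms(4)] assms(3) by linarith
  hence z: "norm (exp (- \<zeta>)) < 1" and r: "norm (exp (- ?R)) < 1" using assms(3) by auto
  have pos: "?A ?R > 0" "?B ?R > 0"
    using assms(2) norm_one_minus_mult_pos[of _ "exp (- ?R)", OF _ r] by simp_all
  have AB: "?A ?R * ?B ?R / 4 \<le> ?A \<zeta> * ?B \<zeta>"
  proof -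
    have "?A ?R * ?B ?R \<le> (2 * ?A \<zeta>) * (2 * ?B \<zeta>)"
      using assms by (intro mult_mono norm_one_minus_exp_comparison) auto
    thus ?thesis by simp
  qed
  have "(?A \<zeta> * ?B \<zeta>) powr (- (lam + 1)) \<le> (?A ?R * ?B ?R / 4) powr (- (lam + 1))"
    using AB pos assms(1) by (intro powr_mono2') auto
  also have "\<dots> = 4 powr (lam + 1) * (?A ?R * ?B ?R) powr (- (lam + 1))"
  proof -
    have "(4::real) powr (- (lam + 1)) = 1 / 4 powr (lam + 1)" by (subst powr_minus) (simp add: divide_inverse)
    thus ?thesis by (subst powr_divide) auto
  qed
  finally have denom: "(?A \<zeta> * ?B \<zeta>) powr (- (lam + 1))
      \<le> 4 powr (lam + 1) * (?A ?R * ?B ?R) powr (- (lam + 1))" .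
  have "norm (1 - (exp (- \<zeta>))\<^sup>2) * (?A \<zeta> * ?B \<zeta>) powr (- (lam + 1))
      \<le> (2 * norm (1 - (exp (- ?R))\<^sup>2)) * (4 powr (lam + 1) * (?A ?R * ?B ?R) powr (- (lam + 1)))"
  proof (rule mult_mono[OF _ denom])
    have "1 - (exp (- ?R))\<^sup>2 = of_real (1 - (exp (- R))\<^sup>2)"
      by (simp add: exp_of_real[symmetric])
    hence eq: "norm (1 - (exp (- ?R))\<^sup>2) = \<bar>1 - (exp (- R))\<^sup>2\<bar>" by (simp only: norm_of_real)
    have "2 * (1 - (exp (- R))\<^sup>2) \<le> 2 * \<bar>1 - (exp (- R))\<^sup>2\<bar>"
      by (intro mult_left_mono abs_ge_self) simp
    with norm_one_minus_exp_square_comparison[OF assms(3,4)]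
    show "norm (1 - (exp (- \<zeta>))\<^sup>2) \<le> 2 * norm (1 - (exp (- ?R))\<^sup>2)"
      unfolding eq by (rule order_trans)
  qed auto
  thus ?thesis unfolding norm_poisson_kernel[OF assms(2) z] norm_poisson_kernel[OF assms(2) r]
    by (simp only: mult_ac)
qed

lemma poisson_kernel_real:
  assumes "norm u = 1" "\<bar>r\<bar> < 1"
  shows "poisson_kernel lam u (of_real r) = of_real (norm (poisson_kernel lam u (of_real r)))"
proof -
  let ?P = "(1 - r\<^sup>2) / (norm (1 - u * of_real r))\<^sup>2 * (1 - 2 * Re u * r + r\<^sup>2) powr (- lam)"
  have "(1 - u * of_real r) * (1 - cnj u * of_real r) = of_real ((norm (1 - u * of_real r))\<^sup>2)"
    unfolding complex_norm_square by simp
  hence "poisson_kernel lam u (of_real r) = of_real ?P"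
    unfolding poisson_kernel_def gegenbauer_gf_real[OF assms] by simp
  moreover have "?P \<ge> 0" using assms(2) abs_square_le_1[of r] by simp
  hence "norm (complex_of_real ?P) = ?P" by (simp only: norm_of_real abs_of_nonneg)
  ultimately show ?thesis by metis
qed

text \<open>
  At real points the Poisson kernel is positive. So the bounds on its modulus become bounds by
  the series itself, which can be integrated term by term.
\<close>

lemma kernel_series_exp:
  assumes "lam > 0" "norm u = 1" "R > 0"
  shows "kernel_series lam (\<lambda>l. exp (- (R * real l))) (Re u)
           = norm (poisson_kernel lam u (exp (- of_real R)))"
proof -
  have t: "Re u \<in> {-1..1}" using abs_Re_le_cmod[of u] assms(2) by auto
  let ?z = "complex_of_real (exp (- R))"
  have z: "exp (- complex_of_real R) = ?z" by (simp add: exp_of_real[symmetric])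
  have "(\<lambda>l. complex_of_real (exp (- (R * real l)) * gegenbauer_kernel lam l (Re u))) sums
           of_real (kernel_series lam (\<lambda>l. exp (- (R * real l))) (Re u))"
    using kernel_series_sums[OF assms(1) kernel_summable_exp[OF assms(1,3)] t]
    by (simp only: sums_of_real_iff)
  moreover have "complex_of_real (exp (- (R * real l)) * gegenbauer_kernel lam l (Re u))
      = of_real (gegenbauer_kernel lam l (Re u)) * ?z ^ l" for l
    by (simp add: mult.commute flip: of_real_power exp_of_nat_mult)
  ultimately have "(\<lambda>l. of_real (gegenbauer_kernel lam l (Re u)) * ?z ^ l) sums
      of_real (kernel_series lam (\<lambda>l. exp (- (R * real l))) (Re u))" by (simp only:)
  moreover have "norm ?z < 1" using assms(3) by simp
  ultimately have "of_real (kernel_series lam (\<lambda>l. exp (- (R * real l))) (Re u)) = poisson_kernel lam u ?z"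
    using sums_unique2[OF _ poisson_kernel_sums[OF assms(1,2), of ?z]] by simp
  also have "\<dots> = of_real (norm (poisson_kernel lam u ?z))"
    using assms by (intro poisson_kernel_real) auto
  finally show ?thesis unfolding z by (simp only: of_real_eq_iff)
qed

text \<open>
  Up to sign, the contribution of \<open>(R l)\<^sup>j / j! exp (- R l)\<close> to the series is
  \<open>R\<^sup>j / j!\<close> times the \<open>j\<close>-th derivative at \<open>R\<close> of the Poisson kernel, as a function of
  \<open>\<zeta>\<close> in \<open>z = exp (- \<zeta>)\<close>. Cauchy's inequality on the circle of radius \<open>R / 2\<close> bounds that
  derivative by \<open>j! (2 / R)\<^sup>j\<close> times the maximum modulus of the Poisson kernel there, and the
  powers of \<open>R\<close> cancel. Cauchy's inequality is applied to the partial sums \<open>U N\<close>, whose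
  derivatives are explicit; \<open>\<tau> N\<close> bounds the remainder on the disc.
\<close>

lemma abs_kernel_series_poisson_tail_le:
  assumes "lam > 0" "R > 0" "t \<in> {-1..1}"
  shows "\<bar>kernel_series lam (\<lambda>l. poisson_tail m (R * real l)) t\<bar>
           \<le> (\<Sum>j<m. 2 ^ j) * (2 * 4 powr (lam + 1)) * kernel_series lam (\<lambda>l. exp (- (R * real l))) t"
proof -
  obtain u where u: "norm u = 1" "Re u = t" using Re_circle_point[OF assms(3)] .
  let ?K = "\<lambda>l. gegenbauer_kernel lam l t"
  define P where "P = 2 * 4 powr (lam + 1) * kernel_series lam (\<lambda>l. exp (- (R * real l))) t"
  define U where "U N \<zeta> = (\<Sum>l<N. complex_of_real (?K l) * exp (- (of_nat l * \<zeta>)))" for N \<zeta>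
  define b where "b l = gegenbauer_kernel lam l 1 * exp (- (R / 2)) ^ l" for l
  define \<tau> where "\<tau> N = suminf b - sum b {..<N}" for N
  have sb: "summable b" unfolding b_def[abs_def]
    using assms by (intro summable_gegenbauer_kernel_1) auto
  have U_bound: "norm (U N \<zeta>) \<le> P + \<tau> N" if \<zeta>: "norm (\<zeta> - of_real R) \<le> R / 2" for N \<zeta>
  proof -
    let ?z = "exp (- \<zeta>)" and ?f = "\<lambda>l. complex_of_real (?K l) * exp (- \<zeta>) ^ l"
    have z: "norm ?z \<le> exp (- (R / 2))" using Re_ge_half[OF \<zeta>] by simp
    also have "\<dots> < 1" using assms(2) by simp
    finally have f: "?f sums poisson_kernel lam u ?z"
      using poisson_kernel_sums[OF assms(1) u(1)] u(2) by simp
    have "U N \<zeta> = sum ?f {..<N}"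
      unfolding U_def by (simp add: exp_of_nat_mult[symmetric])
    also have "\<dots> = poisson_kernel lam u ?z - (\<Sum>l. ?f (l + N))"
      using suminf_minus_initial_segment[OF sums_summable[OF f], of N] sums_unique[OF f] by simp
    finally have "norm (U N \<zeta>) \<le> norm (poisson_kernel lam u ?z) + norm (\<Sum>l. ?f (l + N))"
      by (simp add: norm_triangle_ineq4)
    also have "norm (\<Sum>l. ?f (l + N)) \<le> (\<Sum>l. b (l + N))"
    proof (rule norm_suminf_le)
      show "summable (\<lambda>l. b (l + N))" using sb by (subst summable_iff_shift)
      show "norm (?f (l + N)) \<le> b (l + N)" for l
        unfolding b_def norm_mult norm_power norm_of_real
        using abs_gegenbauer_kernel_le[OF assms(1,3)] z
        by (intro mult_mono power_mono) (auto simp: gegenbauer_kernel_1_nonneg[OF assms(1)])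
    qed
    also have "\<dots> = \<tau> N" unfolding \<tau>_def by (rule suminf_minus_initial_segment[OF sb])
    also have "norm (poisson_kernel lam u ?z) \<le> P"
      using norm_poisson_kernel_comparison[OF assms(1) u(1) assms(2) \<zeta>]
        kernel_series_exp[OF assms(1) u(1) assms(2)] u(2) by (simp add: P_def)
    finally show ?thesis by simp
  qed
  have partial: "\<bar>\<Sum>l<N. poisson_tail m (R * real l) * ?K l\<bar> \<le> (\<Sum>j<m. 2 ^ j) * (P + \<tau> N)" for N
  proof -
    have cauchy: "\<bar>R ^ j / fact j * (\<Sum>l<N. ?K l * real l ^ j * exp (- (R * real l)))\<bar> \<le> 2 ^ j * (P + \<tau> N)" for j
    proof -
      have "norm ((deriv ^^ j) (U N) (of_real R)) \<le> fact j * (P + \<tau> N) / (R / 2) ^ j"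
      proof (rule Cauchy_inequality)
        show "U N holomorphic_on ball (of_real R) (R / 2)" "continuous_on (cball (of_real R) (R / 2)) (U N)"
          unfolding U_def[abs_def] by (intro holomorphic_intros continuous_intros)+
        show "norm (U N x) \<le> P + \<tau> N" if "norm (of_real R - x) = R / 2" for x
          using that by (intro U_bound) (simp add: norm_minus_commute)
      qed (use assms in auto)
      moreover have "(deriv ^^ j) (U N) (of_real R)
          = of_real ((-1) ^ j * (\<Sum>l<N. ?K l * real l ^ j * exp (- (R * real l))))"
        unfolding U_def[abs_def] higher_deriv_exp_sum
        by (simp add: sum_distrib_left power_minus[of "of_nat _"] exp_of_real[symmetric] mult_ac)
      ultimately have "\<bar>\<Sum>l<N. ?K l * real l ^ j * exp (- (R * real l))\<bar> \<le> fact j * (P + \<tau> N) / (R / 2) ^ j"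
        by (simp only: norm_of_real abs_mult power_abs) simp
      hence "R ^ j / fact j * \<bar>\<Sum>l<N. ?K l * real l ^ j * exp (- (R * real l))\<bar>
          \<le> R ^ j / fact j * (fact j * (P + \<tau> N) / (R / 2) ^ j)"
        using assms(2) by (intro mult_left_mono) auto
      also have "\<dots> = 2 ^ j * (P + \<tau> N)" using assms(2) by (simp add: power_divide)
      finally show ?thesis using assms(2) by (simp add: abs_mult)
    qed
    have "(\<Sum>l<N. poisson_tail m (R * real l) * ?K l)
        = (\<Sum>j<m. R ^ j / fact j * (\<Sum>l<N. ?K l * real l ^ j * exp (- (R * real l))))"
      unfolding poisson_tail_def sum_distrib_left sum_distrib_right
      by (subst sum.swap) (intro sum.cong refl, simp add: power_mult_distrib)
    also have "\<bar>\<dots>\<bar> \<le> (\<Sum>j<m. 2 ^ j * (P + \<tau> N))"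
      by (intro order_trans[OF sum_abs] sum_mono cauchy)
    finally show ?thesis by (simp only: sum_distrib_right)
  qed
  have "(\<lambda>N. \<bar>\<Sum>l<N. poisson_tail m (R * real l) * ?K l\<bar>)
      \<longlonglongrightarrow> \<bar>kernel_series lam (\<lambda>l. poisson_tail m (R * real l)) t\<bar>"
    using kernel_series_sums[OF assms(1) kernel_summable_poisson_tail[OF assms(1,2)] assms(3)]
    unfolding sums_def by (rule tendsto_rabs)
  moreover have "(\<lambda>N. (\<Sum>j<m. 2 ^ j) * (P + \<tau> N)) \<longlonglongrightarrow> (\<Sum>j<m. 2 ^ j) * (P + (suminf b - suminf b))"
    unfolding \<tau>_def using summable_LIMSEQ[OF sb] by (intro tendsto_intros)
  ultimately have "\<bar>kernel_series lam (\<lambda>l. poisson_tail m (R * real l)) t\<bar>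
      \<le> (\<Sum>j<m. 2 ^ j) * (P + (suminf b - suminf b))"
    using partial by (intro LIMSEQ_le) auto
  thus ?thesis by (simp add: P_def mult.assoc)
qed

text \<open>
  The constant 1 and the Poisson kernel have the same weighted integral, for every \<open>R\<close>.
\<close>

lemma integral_abs_kernel_series_poisson_tail:
  fixes m :: nat
  assumes "lam \<ge> 1/2" "R > 0"
  defines "F \<equiv> \<lambda>t. kernel_series lam (\<lambda>l. poisson_tail m (R * real l)) t - 1"
  shows "set_integrable lborel {-1..1} (\<lambda>t. \<bar>F t\<bar> * gegenbauer_weight lam t)"
    and "(LINT t:{-1..1}|lborel. \<bar>F t\<bar> * gegenbauer_weight lam t)
           \<le> 2 * ((\<Sum>j<m. 2 ^ j) * (2 * 4 powr (lam + 1)) + 1)"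
proof -
  let ?D = "(\<Sum>j<m. 2 ^ j) * (2 * 4 powr (lam + 1)) :: real" and ?w = "gegenbauer_weight lam"
  let ?P = "kernel_series lam (\<lambda>l. exp (- (R * real l)))"
  let ?W = "LINT t:{-1..1}|lborel. ?w t"
  have pos: "lam > 0" using assms(1) by simp
  note contF = continuous_on_kernel_series[OF pos kernel_summable_poisson_tail[OF pos assms(2)], of m]
  note contP = continuous_on_kernel_series[OF pos kernel_summable_exp[OF pos assms(2)]]
  show int: "set_integrable lborel {-1..1} (\<lambda>t. \<bar>F t\<bar> * ?w t)"
    unfolding F_def by (intro set_integrable_times_weight assms continuous_intros contF)
  have intP: "set_integrable lborel {-1..1} (\<lambda>t. ?P t * ?w t)"
    by (intro set_integrable_times_weight assms contP)
  have intw: "set_integrable lborel {-1..1} ?w"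
    using set_integrable_times_weight[OF assms(1), of "\<lambda>_. 1"] by simp
  have "(LINT t:{-1..1}|lborel. \<bar>F t\<bar> * ?w t) \<le> (LINT t:{-1..1}|lborel. ?D * (?P t * ?w t) + ?w t)"
  proof (rule set_integral_mono[OF int])
    show "set_integrable lborel {-1..1} (\<lambda>t. ?D * (?P t * ?w t) + ?w t)"
      by (intro set_integral_add set_integrable_mult_right intP intw)
    fix t :: real assume t: "t \<in> {-1..1}"
    have "\<bar>F t\<bar> \<le> ?D * ?P t + 1"
      using abs_kernel_series_poisson_tail_le[OF pos assms(2) t, of m] unfolding F_def by linarith
    from mult_right_mono[OF this gegenbauer_weight_bounds(1)[OF assms(1) t]]
    show "\<bar>F t\<bar> * ?w t \<le> ?D * (?P t * ?w t) + ?w t" by (simp only: distrib_right mult_1 mult.assoc)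
  qed
  also have "\<dots> = ?D * (LINT t:{-1..1}|lborel. ?P t * ?w t) + ?W"
    by (subst set_integral_add(2)) (simp_all only: set_integral_mult_right set_integrable_mult_right intP intw)
  also have "(LINT t:{-1..1}|lborel. ?P t * ?w t) = ?W"
    using LINT_kernel_series_weight[OF assms(1) kernel_summable_exp[OF pos assms(2)]] by simp
  also have "?D * ?W + ?W = ?W * (?D + 1)" by (simp add: algebra_simps)
  also have "\<dots> \<le> 2 * (?D + 1)"
    using LINT_weight_le[OF assms(1)] by (intro mult_right_mono) (auto intro!: add_nonneg_nonneg mult_nonneg_nonneg sum_nonneg)
  finally show "(LINT t:{-1..1}|lborel. \<bar>F t\<bar> * ?w t) \<le> 2 * (?D + 1)" .
qed

section \<open>Zonal functions and the wavelet property\<close>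

text \<open>
  A bounded function on a space of finite measure: the surface measure of the sphere is a
  multiple of the volume of the unit ball.
\<close>

lemma zonal_L2_continuous:
  fixes e :: "'a::euclidean_space"
  assumes "norm e = 1" "continuous_on {-1..1} f"
  shows "zonal_L2 e f"
proof -
  let ?M = "sphere_surface :: 'a measure"
  have e: "e \<bullet> x \<in> {-1..1}" if "x \<in> sphere 0 1" for x
    using Cauchy_Schwarz_ineq2[of e x] that assms(1) by auto
  have space: "space ?M = sphere 0 1" and sets: "sets ?M = sets (restrict_space borel (sphere 0 1))"
    by (simp_all add: sphere_surface_def space_restrict_space space_scale_measure)
  have "continuous_on (sphere 0 1) (\<lambda>x. f (e \<bullet> x))"
    using e by (intro continuous_on_compose2[OF assms(2)] continuous_intros) auto
  hence meas: "(\<lambda>x. f (e \<bullet> x)) \<in> borel_measurable ?M"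
    unfolding measurable_cong_sets[OF sets refl] by (rule borel_measurable_continuous_on_restrict)
  have "emeasure ?M (space ?M) = ennreal (real DIM('a)) * emeasure lborel {x \<in> cball 0 1 - {0::'a}. sgn x \<in> sphere 0 1}"
    unfolding space by (rule emeasure_sphere_surface) (auto simp: sets_restrict_space)
  moreover have "emeasure lborel {x \<in> cball 0 1 - {0::'a}. sgn x \<in> sphere 0 1} \<le> emeasure lborel (cball (0::'a) 1)"
    by (intro emeasure_mono) auto
  hence "emeasure lborel {x \<in> cball 0 1 - {0::'a}. sgn x \<in> sphere 0 1} < \<infinity>"
    using emeasure_lborel_cball_finite by (rule le_less_trans)
  ultimately interpret finite_measure ?M
    by (intro finite_measureI) (auto simp: ennreal_mult_eq_top_iff)
  have "compact (f ` {-1..1})" by (intro compact_continuous_image assms) auto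
  hence "bounded (f ` {-1..1})" by (rule compact_imp_bounded)
  then obtain B where "\<forall>y\<in>f ` {-1..1}. norm y \<le> B" unfolding bounded_iff by blast
  hence B: "\<bar>f t\<bar> \<le> B" if "t \<in> {-1..1}" for t using that by auto
  have "integrable ?M (\<lambda>x. (f (e \<bullet> x))\<^sup>2)"
  proof (rule integrable_const_bound)
    have "(f (e \<bullet> x))\<^sup>2 \<le> B\<^sup>2" if "x \<in> sphere 0 1" for x
      using power_mono[OF B[OF e[OF that]], of 2] by simp
    thus "AE x in ?M. norm ((f (e \<bullet> x))\<^sup>2) \<le> B\<^sup>2"
      by (intro AE_I2) (simp add: space)
  qed (use meas in measurable)
  thus ?thesis unfolding zonal_L2_def using meas by blast
qed

theorem theorem9p2:
  fixes n m :: nat and lam :: real and e :: "'a::euclidean_space"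
  assumes "n \<ge> 2"
    and "DIM('a) = n + 1"
    and "e \<in> Basis"
    and "lam = (real n - 1) / 2"
    and "m \<ge> 1"
  shows "spherical_linear_wavelet {1..} e lam (poisson_wavelet lam m)"
proof -
  have lam: "lam \<ge> 1/2" using assms(1,4) by simp
  hence pos: "lam > 0" by simp
  let ?\<Psi> = "poisson_wavelet lam m"
  let ?c = "\<lambda>a l. poisson_profile m (a * real l) * ((lam + real l) / lam)"
  note summable = kernel_summable_poisson_profile[OF pos assms(5)]
  have expansion: "gegenbauer_expansion lam (?\<Psi> a) (?c a)" if "a > 0" for a
    unfolding poisson_wavelet_eq_kernel_series
    by (rule gegenbauer_expansion_kernel_series[OF lam summable[OF that]])
  have ex1: "\<exists>!c. gegenbauer_expansion lam (?\<Psi> a) c" if "a > 0" for a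
    using expansion[OF that] gegenbauer_expansion_unique[OF lam] by blast
  have coeff: "gegenbauer_coeff lam (?\<Psi> a) = ?c a" if "a > 0" for a
    unfolding gegenbauer_coeff_def
    using expansion[OF that] gegenbauer_expansion_unique[OF lam] by (intro the_equality) blast+
  have zonal: "zonal_L2 e (?\<Psi> a)" if "a > 0" for a
    unfolding poisson_wavelet_eq_kernel_series using assms(3)
    by (intro zonal_L2_continuous continuous_on_kernel_series pos summable[OF that]) auto
  have admissible: "set_integrable lborel {0<..} (\<lambda>a. gegenbauer_coeff lam (?\<Psi> a) l / a)"
    "(LINT a:{0<..}|lborel. gegenbauer_coeff lam (?\<Psi> a) l / a) = (lam + real l) / lam" if "l \<ge> 1" for l
  proof -
    have "has_bochner_integral lborel
        (\<lambda>a. (lam + real l) / lam * (indicator {0<..} a *\<^sub>R (poisson_profile m (a * real l) / a))) ((lam + real l) / lam)"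
      using has_bochner_integral_mult_right[OF poisson_profile_integral[OF assms(5) that order_refl], of "(lam + real l) / lam"]
      by (simp add: poisson_tail_0[OF assms(5)])
    moreover have "(lam + real l) / lam * (indicator {0<..} a *\<^sub>R (poisson_profile m (a * real l) / a))
        = indicator {0<..} a *\<^sub>R (gegenbauer_coeff lam (?\<Psi> a) l / a)" for a
      by (cases "a > 0") (simp_all add: coeff)
    ultimately have "has_bochner_integral lborel
        (\<lambda>a. indicator {0<..} a *\<^sub>R (gegenbauer_coeff lam (?\<Psi> a) l / a)) ((lam + real l) / lam)" by simp
    thus "set_integrable lborel {0<..} (\<lambda>a. gegenbauer_coeff lam (?\<Psi> a) l / a)"
      "(LINT a:{0<..}|lborel. gegenbauer_coeff lam (?\<Psi> a) l / a) = (lam + real l) / lam"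
      unfolding set_integrable_def set_lebesgue_integral_def by (simp_all add: has_bochner_integral_iff)
  qed
  note scale = scale_integral_poisson_wavelet[OF pos assms(5)]
  have "set_integrable lborel {-1..1} (\<lambda>t. \<bar>LINT a:{R<..}|lborel. ?\<Psi> a t / a\<bar> * gegenbauer_weight lam t) \<and>
    (LINT t:{-1..1}|lborel. \<bar>LINT a:{R<..}|lborel. ?\<Psi> a t / a\<bar> * gegenbauer_weight lam t)
      \<le> 2 * ((\<Sum>j<m. 2 ^ j) * (2 * 4 powr (lam + 1)) + 1)" if "R > 0" for R
  proof -
    let ?F = "\<lambda>t. kernel_series lam (\<lambda>l. poisson_tail m (R * real l)) t - 1"
    have "set_integrable lborel {-1..1} (\<lambda>t. \<bar>LINT a:{R<..}|lborel. ?\<Psi> a t / a\<bar> * gegenbauer_weight lam t)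
       \<longleftrightarrow> set_integrable lborel {-1..1} (\<lambda>t. \<bar>?F t\<bar> * gegenbauer_weight lam t)"
      using scale(2)[OF that] by (intro set_integrable_cong) auto
    moreover have "(LINT t:{-1..1}|lborel. \<bar>LINT a:{R<..}|lborel. ?\<Psi> a t / a\<bar> * gegenbauer_weight lam t)
       = (LINT t:{-1..1}|lborel. \<bar>?F t\<bar> * gegenbauer_weight lam t)"
      using scale(2)[OF that] by (intro set_lebesgue_integral_cong) auto
    ultimately show ?thesis using integral_abs_kernel_series_poisson_tail[OF lam that, of m] by simp
  qed
  moreover have "AE t in lborel. t \<in> {-1..1} \<longrightarrow> set_integrable lborel {R<..} (\<lambda>a. ?\<Psi> a t / a)" if "R > 0" for R
    using scale(1)[OF that] by (intro AE_I2) blast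
  ultimately show ?thesis
    unfolding spherical_linear_wavelet_def using zonal ex1 admissible by auto
qed

end
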